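(* Let $D\in(0,\infty]$ and let $a,b$ be Borel measurable on $[0,D]$ with $a>0$ on $(0,D)$ and with $b/a$ and $e^{C}/a$ locally integrable on $[0,D]$, where $C(x)=\int_0^x \frac{b(u)}{a(u)}\,du$. Let $\lambda_0$ be the mixed (Neumann at $0$, Dirichlet at $D$) principal eigenvalue and $II$ the double integral operator defined in the context. Assume that $\delta:=\sup_{x\in(0,D)}\mu(0,x)\,\nu(x,D)<\infty$, and set $\varphi(x)=\nu(x,D)$. (1) Let $f_1=\sqrt\varphi$, $f_n=f_{n-1}\,II(f_{n-1})$ for $n\ge2$, and $\delta_n=\sup_{x\in(0,D)}II(f_n)(x)$. Then $\delta_n$ is decreasing in $n$ and $$\lambda_0\ge\delta_n^{-1}\ge(4\delta)^{-1},\qquad n\ge1.$$ (2) For fixed $x_0,x_1\in[0,D)$ with $x_0<x_1$, define $$f_1^{x_0,x_1}=\nu(\cdot\vee x_0,\,x_1)\,\mathbf 1_{[0,x_1)},\qquad f_n^{x_0,x_1}=\big(f_{n-1}^{x_0,x_1}\,II(f_{n-1}^{x_0,x_1})\big)(\cdot\vee x_0)\,\mathbf 1_{[0,x_1)},\quad n\ge2,$$ and let $\delta_n'=\sup_{x_0,x_1:\,x_0<x_1}\ \inf_{x<x_1}II(f_n^{x_0,x_1})(x)$. Then $$\delta^{-1}\ge{\delta_n'}^{-1}\ge\lambda_0,\qquad n\ge1.$$ (3) Define $$\bar\delta_n=\sup_{x_0,x_1:\,x_0<x_1}\frac{\mu\big((f_n^{x_0,x_1})^2\big)}{D(f_n^{x_0,x_1})},\qquad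 n\ge1.$$ Then $\bar\delta_n^{-1}\ge\lambda_0$ and $\bar\delta_{n+1}\ge\delta_n'$ for $n\ge1$, and $\bar\delta_1=\delta_1'$.
   Context: When $D=\infty$, $[0,D]$ is read as $[0,\infty)$ and $\mathcal C[0,D]$ as $\mathcal C[0,\infty)$. $\mu(dx)=\frac{e^{C(x)}}{a(x)}dx$, $\nu(dx)=e^{-C(x)}dx$, $\mu(\alpha,\beta)=\int_\alpha^\beta d\mu$, $\nu(\alpha,\beta)=\int_\alpha^\beta d\nu$, $\mu(f)=\int_0^D f\,d\mu$, $D(f)=\int_0^D a\,f'^2\,d\mu=\int_0^D e^{C}f'^2dx$ (for functions supported on $[0,x_1)$ and vanishing continuously at $x_1$, absolutely continuous, $f'$ is taken a.e.; the functional $D(\cdot)$ is distinct from the endpoint $D$). With $\mathcal C_K[0,D]=\{f\in\mathcal C^1(0,D)\cap\mathcal C[0,D]: f\text{ has compact support}\}$, $$\lambda_0=\inf\{D(f):\mu(f^2)=1,\ f\in\mathcal C_K[0,D],\ f(D)=0\text{ if }D<\infty\}.$$ With $\mathrm{supp}(f)=\{x:f(x)\ne0\}$, $$II(f)(x)=\frac1{f(x)}\int_{(x,D)\cap\mathrm{supp}(f)}\nu(ds)\int_0^s f\,d\mu,\qquad x\in\mathrm{supp}(f).$$ *)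

theory Defs
  imports "HOL-Analysis.Analysis"
begin

text \<open>
  The right endpoint \<open>D\<close> is an extended real with \<open>0 < D\<close>. The open interval \<open>(\<alpha>, \<beta>)\<close> is
  \<open>einterval \<alpha> \<beta>\<close>. All nonnegative quantities that may be infinite a priori live in
  \<open>ennreal\<close>, where \<open>inverse 0 = \<infinity>\<close> and \<open>inverse \<infinity> = 0\<close>.
\<close>

text \<open>\<open>[0, D]\<close>, read as \<open>[0, \<infinity>)\<close> when \<open>D = \<infinity>\<close>.\<close>

definition closed_dom :: "ereal \<Rightarrow> real set" where
  "closed_dom D = {x. 0 \<le> x \<and> ereal x \<le> D}"

definition locally_integrable_on :: "(real \<Rightarrow> real) \<Rightarrow> real set \<Rightarrow> bool" where
  "locally_integrable_on f S \<longleftrightarrow> (\<forall>K. compact K \<and> K \<subseteq> S \<longrightarrow> set_integrable lborel K f)"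

text \<open>The next function is only meaningful for \<open>x \<ge> 0\<close>.\<close>

definition Cfun :: "(real \<Rightarrow> real) \<Rightarrow> (real \<Rightarrow> real) \<Rightarrow> real \<Rightarrow> real" where
  "Cfun a b x = (LBINT u:{0..x}. b u / a u)"

text \<open>The measures \<open>\<mu>\<close> and \<open>\<nu>\<close> are carried by \<open>(0, D)\<close>.\<close>

definition mu :: "(real \<Rightarrow> real) \<Rightarrow> (real \<Rightarrow> real) \<Rightarrow> ereal \<Rightarrow> real measure" where
  "mu a b D = density lborel
     (\<lambda>x. ennreal (exp (Cfun a b x) / a x) * indicator (einterval 0 D) x)"

definition nu :: "(real \<Rightarrow> real) \<Rightarrow> (real \<Rightarrow> real) \<Rightarrow> ereal \<Rightarrow> real measure" where
  "nu a b D = density lborel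
     (\<lambda>x. ennreal (exp (- Cfun a b x)) * indicator (einterval 0 D) x)"

definition mu_sq :: "(real \<Rightarrow> real) \<Rightarrow> (real \<Rightarrow> real) \<Rightarrow> ereal \<Rightarrow> (real \<Rightarrow> real) \<Rightarrow> ennreal" where
  "mu_sq a b D f = (\<integral>\<^sup>+x. ennreal ((f x)\<^sup>2) \<partial>mu a b D)"

text \<open>
  The form \<open>D(f) = \<integral> a f'\<^sup>2 d\<mu>\<close>. It is only applied to functions that are differentiable
  on \<open>(0, D)\<close> outside a null set; the arbitrary value of \<^const>\<open>deriv\<close> on that null set
  does not matter.
\<close>

definition dirichlet ::
  "(real \<Rightarrow> real) \<Rightarrow> (real \<Rightarrow> real) \<Rightarrow> ereal \<Rightarrow> (real \<Rightarrow> real) \<Rightarrow> ennreal" where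
  "dirichlet a b D f = (\<integral>\<^sup>+x. ennreal (a x * (deriv f x)\<^sup>2) \<partial>mu a b D)"

definition C_K :: "ereal \<Rightarrow> (real \<Rightarrow> real) set" where
  "C_K D = {f. f C1_differentiable_on einterval 0 D \<and> continuous_on (closed_dom D) f \<and>
               compact (closure {x \<in> closed_dom D. f x \<noteq> 0})}"

definition lambda0 :: "(real \<Rightarrow> real) \<Rightarrow> (real \<Rightarrow> real) \<Rightarrow> ereal \<Rightarrow> ennreal" where
  "lambda0 a b D = Inf {dirichlet a b D f | f.
     mu_sq a b D f = 1 \<and> f \<in> C_K D \<and> (D < \<infinity> \<longrightarrow> f (real_of_ereal D) = 0)}"

definition delta :: "(real \<Rightarrow> real) \<Rightarrow> (real \<Rightarrow> real) \<Rightarrow> ereal \<Rightarrow> ennreal" where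
  "delta a b D = (SUP x\<in>einterval 0 D.
     emeasure (mu a b D) (einterval 0 x) * emeasure (nu a b D) (einterval x D))"

text \<open>Used for nonnegative \<open>f\<close> at points where \<open>f x > 0\<close>.\<close>

definition II ::
  "(real \<Rightarrow> real) \<Rightarrow> (real \<Rightarrow> real) \<Rightarrow> ereal \<Rightarrow> (real \<Rightarrow> real) \<Rightarrow> real \<Rightarrow> ennreal" where
  "II a b D f x =
     (\<integral>\<^sup>+s\<in>einterval x D \<inter> {s. f s \<noteq> 0}.
        (\<integral>\<^sup>+u\<in>einterval 0 s. ennreal (f u) \<partial>mu a b D) \<partial>nu a b D) / ennreal (f x)"

text \<open>
  The iterations below produce real functions. The conversions \<^const>\<open>enn2real\<close> and
  \<^const>\<open>measure\<close> lose nothing there: if \<open>\<delta> < \<infinity>\<close>, then \<open>\<nu>(x, D) < \<infinity>\<close> and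
  \<open>II(f) \<le> 4 \<delta>\<close> along the first sequence, and the functions of the second family are bounded
  and vanish outside \<open>[0, x\<^sub>1)\<close>, on which \<open>\<mu>\<close> and \<open>\<nu>\<close> are finite. Outside the support of \<open>f\<close> the factor
  \<open>f x = 0\<close> makes \<open>f II(f)\<close> vanish. Indices start at \<open>1\<close>.
\<close>

definition f_seq ::
  "(real \<Rightarrow> real) \<Rightarrow> (real \<Rightarrow> real) \<Rightarrow> ereal \<Rightarrow> nat \<Rightarrow> real \<Rightarrow> real" where
  "f_seq a b D n =
     ((\<lambda>f x. enn2real (ennreal (f x) * II a b D f x)) ^^ (n - 1))
       (\<lambda>x. sqrt (measure (nu a b D) (einterval x D)))"

definition delta_n :: "(real \<Rightarrow> real) \<Rightarrow> (real \<Rightarrow> real) \<Rightarrow> ereal \<Rightarrow> nat \<Rightarrow> ennreal" where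
  "delta_n a b D n = (SUP x\<in>einterval 0 D. II a b D (f_seq a b D n) x)"

definition f_loc ::
  "(real \<Rightarrow> real) \<Rightarrow> (real \<Rightarrow> real) \<Rightarrow> ereal \<Rightarrow> real \<Rightarrow> real \<Rightarrow> nat \<Rightarrow> real \<Rightarrow> real" where
  "f_loc a b D x\<^sub>0 x\<^sub>1 n =
     ((\<lambda>f x. enn2real (ennreal (f (max x x\<^sub>0)) * II a b D f (max x x\<^sub>0)) * indicator {0..<x\<^sub>1} x)
        ^^ (n - 1))
       (\<lambda>x. measure (nu a b D) (einterval (max x x\<^sub>0) x\<^sub>1) * indicator {0..<x\<^sub>1} x)"

definition ordered_pairs :: "ereal \<Rightarrow> (real \<times> real) set" where
  "ordered_pairs D = {(x\<^sub>0, x\<^sub>1). 0 \<le> x\<^sub>0 \<and> x\<^sub>0 < x\<^sub>1 \<and> ereal x\<^sub>1 < D}"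

definition delta'_n :: "(real \<Rightarrow> real) \<Rightarrow> (real \<Rightarrow> real) \<Rightarrow> ereal \<Rightarrow> nat \<Rightarrow> ennreal" where
  "delta'_n a b D n = (SUP (x\<^sub>0, x\<^sub>1)\<in>ordered_pairs D.
     INF x\<in>{0..<x\<^sub>1}. II a b D (f_loc a b D x\<^sub>0 x\<^sub>1 n) x)"

definition delta_bar :: "(real \<Rightarrow> real) \<Rightarrow> (real \<Rightarrow> real) \<Rightarrow> ereal \<Rightarrow> nat \<Rightarrow> ennreal" where
  "delta_bar a b D n = (SUP (x\<^sub>0, x\<^sub>1)\<in>ordered_pairs D.
     mu_sq a b D (f_loc a b D x\<^sub>0 x\<^sub>1 n) / dirichlet a b D (f_loc a b D x\<^sub>0 x\<^sub>1 n))"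

end

theory Submission
  imports Defs
begin

text \<open>
  Two observations carry the whole proof. In terms of \<open>\<nu>\<close> the form is \<open>D(f) = \<integral> (f' e\<^sup>C)\<^sup>2 d\<nu>\<close>
  (\<open>dirichlet_eq\<close>), and the two halves of the operator \<open>II\<close> are adjoint to each other: by Tonelli,
  \<open>\<integral> f(x) \<nu>(g 1\<^bsub>(x, D)\<^esub>) \<mu>(dx) = \<integral> g(s) \<mu>(f 1\<^bsub>(0, s)\<^esub>) \<nu>(ds)\<close> (\<open>nn_integral_mult_tail\<close>).
  Below, \<open>left_mass f s\<close> is \<open>\<mu>(f 1\<^bsub>(0, s)\<^esub>)\<close> and \<open>tail g x\<close> is \<open>\<nu>(g 1\<^bsub>(x, D)\<^esub>)\<close>, so that
  \<open>f II(f) = tail (left_mass f)\<close> for positive \<open>f\<close>.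

  Lower bounds for \<open>\<lambda>\<^sub>0\<close>. Let \<open>g > 0\<close> be a supersolution, \<open>g II(g) \<le> c g\<close>, with left mass \<open>H\<close>, and let
  \<open>f\<close> be a test function. As \<open>f\<close> vanishes at \<open>D\<close>, \<open>\<bar>f(x)\<bar>\<close> is at most the integral of \<open>\<bar>f'\<bar>\<close> over
  \<open>(x, D)\<close>, and Cauchy--Schwarz with the weight \<open>H\<close> bounds \<open>f(x)\<^sup>2\<close> by \<open>g(x) II(g)(x)\<close> times the
  \<open>\<nu>\<close>-tail of \<open>(f' e\<^sup>C)\<^sup>2 / H\<close>. Integration against \<open>\<mu>\<close> and the exchange of integrals produce the factor
  \<open>H\<close> that cancels the weight, and \<open>\<mu>(f\<^sup>2) \<le> c D(f)\<close> remains (\<open>mu_sq_le_dirichlet\<close>). The step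
  \<open>g \<mapsto> g II(g)\<close> keeps the constant \<open>c\<close> (\<open>iterate_positive\<close>), which makes \<open>\<delta>\<^sub>n\<close> decreasing, and
  \<open>\<surd>\<phi>\<close> is a supersolution for \<open>c = 4 \<delta>\<close> (\<open>tail_left_mass_sqrt_phi\<close>), an instance of Hardy's inequality.

  Upper bounds for \<open>\<lambda>\<^sub>0\<close>. Every localised function is a \<open>\<nu>\<close>-tail of \<open>h 1\<^bsub>(x\<^sub>0, x\<^sub>1)\<^esub>\<close> for a continuous
  \<open>h\<close>: \<open>h = 1\<close> for the first one, and the left mass of the preceding function later on. It has corners at
  \<open>x\<^sub>0\<close> and \<open>x\<^sub>1\<close>, but continuous cutoffs of \<open>h\<close> yield \<open>C\<^sup>1\<close> test functions of no larger energy
  that increase to it, hence \<open>\<lambda>\<^sub>0 \<mu>(f\<^sup>2) \<le> D(f)\<close> (\<open>lambda0_tail_function\<close>). If \<open>c \<le> II(f)\<close> on \<open>[0, x\<^sub>1)\<close>, then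
  the next function \<open>F\<close> satisfies \<open>c f \<le> F\<close>, while the exchange of integrals gives \<open>D(F) = \<mu>(f F)\<close>;
  together, \<open>c D(F) \<le> \<mu>(F\<^sup>2)\<close> (\<open>le_Rayleigh_local_iterate\<close>). This compares \<open>\<delta>'\<^sub>n\<close> with the next
  Rayleigh quotient and hence with \<open>\<lambda>\<^sub>0\<close>. Also \<open>c \<le> II(F)\<close>, so \<open>\<delta>'\<^sub>n\<close> increases with \<open>n\<close>, and it
  remains to look at \<open>n = 1\<close>. There \<open>II(f)(x)\<close> is the \<open>\<nu>\<close>-average over \<open>(x, x\<^sub>1)\<close> of an increasing function
  when \<open>x \<ge> x\<^sub>0\<close>, so its infimum is attained at \<open>x\<^sub>0\<close>, where it is the Rayleigh quotient of \<open>f\<close>; that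
  quotient is at least \<open>\<mu>(0, x\<^sub>0) \<nu>(x\<^sub>0, x\<^sub>1)\<close>, and these products have supremum \<open>\<delta>\<close>.
\<close>

section \<open>Two measures on the line\<close>

text \<open>
  Both sides integrate \<open>f(x) g(s)\<close> over the region \<open>x < s\<close>.
\<close>

lemma nn_integral_swap_tails:
  fixes f g :: "real \<Rightarrow> ennreal" and M N :: "real measure"
  assumes "sigma_finite_measure M" "sigma_finite_measure N"
    and [measurable_cong, simp]: "sets M = sets borel" "sets N = sets borel"
    and [measurable]: "f \<in> borel_measurable borel" "g \<in> borel_measurable borel"
  shows "(\<integral>\<^sup>+x. f x * (\<integral>\<^sup>+s\<in>{x<..}. g s \<partial>N) \<partial>M) = (\<integral>\<^sup>+s. g s * (\<integral>\<^sup>+x\<in>{..<s}. f x \<partial>M) \<partial>N)"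
proof -
  interpret M: sigma_finite_measure M by fact
  interpret N: sigma_finite_measure N by fact
  interpret pair_sigma_finite M N ..
  have "(\<integral>\<^sup>+x. f x * (\<integral>\<^sup>+s\<in>{x<..}. g s \<partial>N) \<partial>M)
      = (\<integral>\<^sup>+x. (\<integral>\<^sup>+s. (if x < s then f x * g s else 0) \<partial>N) \<partial>M)"
    by (subst nn_integral_cmult[symmetric])
       (auto intro!: nn_integral_cong split: split_indicator)
  also have "\<dots> = (\<integral>\<^sup>+s. (\<integral>\<^sup>+x. (if x < s then f x * g s else 0) \<partial>M) \<partial>N)"
    by (rule Fubini'[symmetric]) measurable
  also have "\<dots> = (\<integral>\<^sup>+s. g s * (\<integral>\<^sup>+x\<in>{..<s}. f x \<partial>M) \<partial>N)"
    by (subst nn_integral_cmult[symmetric])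
       (auto intro!: nn_integral_cong split: split_indicator simp: mult.commute)
  finally show ?thesis .
qed

lemma borel_measurable_right_tail:
  fixes g :: "real \<Rightarrow> ennreal"
  assumes "sigma_finite_measure N" and [measurable_cong, simp]: "sets N = sets borel"
    and [measurable]: "g \<in> borel_measurable borel"
  shows "(\<lambda>x. \<integral>\<^sup>+s\<in>{x<..}. g s \<partial>N) \<in> borel_measurable borel"
proof -
  interpret N: sigma_finite_measure N by fact
  have "(\<lambda>x. \<integral>\<^sup>+s. (if x < s then g s else 0) \<partial>N) \<in> borel_measurable borel"
    by measurable
  then show ?thesis
    by (simp add: indicator_def of_bool_def if_distrib cong: if_cong)
qed

lemma borel_measurable_left_tail:
  fixes g :: "real \<Rightarrow> ennreal"
  assumes "sigma_finite_measure M" and [measurable_cong, simp]: "sets M = sets borel"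
    and [measurable]: "g \<in> borel_measurable borel"
  shows "(\<lambda>s. \<integral>\<^sup>+x\<in>{..<s}. g x \<partial>M) \<in> borel_measurable borel"
proof -
  interpret M: sigma_finite_measure M by fact
  have "(\<lambda>s. \<integral>\<^sup>+x. (if x < s then g x else 0) \<partial>M) \<in> borel_measurable borel"
    by measurable
  then show ?thesis
    by (simp add: indicator_def of_bool_def if_distrib cong: if_cong)
qed

text \<open>
  Bounds obtained from the fundamental theorem of calculus hold on compact subintervals; exhausting the
  open interval by these transfers them to its endpoints, where an antiderivative may have no value.
\<close>

lemma nn_integral_einterval_le:
  fixes g :: "real \<Rightarrow> ennreal"
  assumes "\<alpha> < \<beta>" and [measurable_cong, simp]: "sets K = sets borel"
    and [measurable]: "g \<in> borel_measurable borel"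
    and bound: "\<And>u v. \<alpha> < ereal u \<Longrightarrow> u < v \<Longrightarrow> ereal v < \<beta> \<Longrightarrow> (\<integral>\<^sup>+s\<in>{u..v}. g s \<partial>K) \<le> c"
  shows "(\<integral>\<^sup>+s\<in>einterval \<alpha> \<beta>. g s \<partial>K) \<le> c"
proof -
  obtain u l :: "nat \<Rightarrow> real" where ul: "einterval \<alpha> \<beta> = (\<Union>i. {l i .. u i})" "incseq u" "decseq l"
    "\<And>i. l i < u i" "\<And>i. \<alpha> < l i" "\<And>i. u i < \<beta>"
    by (rule einterval_Icc_approximation[OF \<open>\<alpha> < \<beta>\<close>]) blast
  have inc: "{l i .. u i} \<subseteq> {l j .. u j}" if "i \<le> j" for i j
    using decseqD[OF ul(3) that] incseqD[OF ul(2) that] by auto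
  have "g s * indicator (einterval \<alpha> \<beta>) s = (SUP i. g s * indicator {l i .. u i} s)" for s
  proof (cases "s \<in> einterval \<alpha> \<beta>")
    case True
    then obtain i where "s \<in> {l i .. u i}" using ul(1) by auto
    then have "g s \<le> (SUP i. g s * indicator {l i .. u i} s)"
      by (intro SUP_upper2[of i]) auto
    moreover have "(SUP i. g s * indicator {l i .. u i} s) \<le> g s"
      by (intro SUP_least) (auto split: split_indicator)
    ultimately show ?thesis using True by auto
  next
    case False
    then have "s \<notin> {l i .. u i}" for i using ul(1) by auto
    with False show ?thesis by simp
  qed
  then have "(\<integral>\<^sup>+s\<in>einterval \<alpha> \<beta>. g s \<partial>K) = (\<integral>\<^sup>+s. (SUP i. g s * indicator {l i .. u i} s) \<partial>K)"
    by simp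
  also have "\<dots> = (SUP i. \<integral>\<^sup>+s. g s * indicator {l i .. u i} s \<partial>K)"
  proof (rule nn_integral_monotone_convergence_SUP)
    show "incseq (\<lambda>i s. g s * indicator {l i .. u i} s)"
    proof (intro incseq_SucI le_funI)
      fix i s
      show "g s * indicator {l i .. u i} s \<le> g s * indicator {l (Suc i) .. u (Suc i)} s"
        using subsetD[OF inc[of i "Suc i"], of s] by (cases "s \<in> {l i .. u i}") simp_all
    qed
  qed simp
  also have "\<dots> \<le> c"
    using ul(4-6) by (intro SUP_least bound) auto
  finally show ?thesis .
qed

lemma nn_integral_density_lborel_pos:
  fixes k g :: "real \<Rightarrow> ennreal"
  assumes [measurable]: "k \<in> borel_measurable borel" "g \<in> borel_measurable borel"
    and "u < v" "\<And>x. u < x \<Longrightarrow> x < v \<Longrightarrow> 0 < k x \<and> 0 < g x"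
  shows "0 < (\<integral>\<^sup>+x\<in>{u<..<v}. g x \<partial>density lborel k)"
proof (rule ccontr)
  assume "\<not> ?thesis"
  then have "(\<integral>\<^sup>+x. k x * (g x * indicator {u<..<v} x) \<partial>lborel) = 0"
    by (simp add: nn_integral_density)
  then have "AE x in lborel. k x * (g x * indicator {u<..<v} x) = 0"
    by (subst (asm) nn_integral_0_iff_AE) auto
  then have "AE x in lborel. x \<notin> {u<..<v}"
    by eventually_elim (use assms(4) in \<open>force split: split_indicator_asm\<close>)
  then have "emeasure lborel {u<..<v} = 0"
    by (subst (asm) AE_iff_measurable[where N="{u<..<v}"]) auto
  with \<open>u < v\<close> show False by simp
qed

section \<open>The speed measure, the scale measure and the Dirichlet form\<close>

locale mixed_eigenvalue_problem =
  fixes a b :: "real \<Rightarrow> real" and D :: ereal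
  assumes D_pos: "0 < D"
    and a_meas: "a \<in> borel_measurable (restrict_space borel (closed_dom D))"
    and a_pos: "\<And>x. x \<in> einterval 0 D \<Longrightarrow> 0 < a x"
    and drift_int: "locally_integrable_on (\<lambda>x. b x / a x) (closed_dom D)"
    and speed_int: "locally_integrable_on (\<lambda>x. exp (Cfun a b x) / a x) (closed_dom D)"
begin

abbreviation "M \<equiv> mu a b D"
abbreviation "N \<equiv> nu a b D"

text \<open>
  The scale density \<open>e\<^sup>-\<^sup>C\<close>. Left of \<open>0\<close> the function \<open>C\<close> is an integral over the empty set,
  so this density is continuous on the whole of \<open>(-\<infinity>, D)\<close>; the value \<open>1\<close> from \<open>D\<close> on only
  keeps it positive and measurable.
\<close>

definition r :: "real \<Rightarrow> real" where
  "r x = (if ereal x < D then exp (- Cfun a b x) else 1)"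

definition m :: "real \<Rightarrow> real" where
  "m x = (if x \<in> einterval 0 D then exp (Cfun a b x) / a x else 0)"

lemma r_pos [simp]: "0 < r x" and r_nonneg [simp]: "0 \<le> r x" and r_neq_0 [simp]: "r x \<noteq> 0"
  by (auto simp: r_def less_imp_le)

lemma m_nonneg [simp]: "0 \<le> m x"
  using a_pos[of x] by (auto simp: m_def)

lemma m_pos: "x \<in> einterval 0 D \<Longrightarrow> 0 < m x"
  using a_pos[of x] by (auto simp: m_def)

lemma mem_dom: "x \<in> einterval 0 D \<longleftrightarrow> 0 < x \<and> ereal x < D"
  by (simp add: einterval_def)

lemma below_D: "t \<le> x \<Longrightarrow> ereal x < D \<Longrightarrow> ereal t < D"
  by (metis ereal_less_eq(3) order_le_less_trans)

lemma below_D': "t < x \<Longrightarrow> ereal x \<le> D \<Longrightarrow> ereal t < D"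
  by (metis less_ereal.simps(1) order_less_le_trans)

lemma Icc_subset_closed_dom: "ereal x < D \<Longrightarrow> {0..x} \<subseteq> closed_dom D"
proof
  fix t assume "ereal x < D" "t \<in> {0..x}"
  then have "ereal t < D" by (intro below_D[of t x]) auto
  with \<open>t \<in> {0..x}\<close> show "t \<in> closed_dom D" by (simp add: closed_dom_def less_imp_le)
qed

lemma locally_integrable_onD:
  "locally_integrable_on f S \<Longrightarrow> compact K \<Longrightarrow> K \<subseteq> S \<Longrightarrow> set_integrable lborel K f"
  by (simp add: locally_integrable_on_def)

lemma continuous_Cfun: "0 \<le> y \<Longrightarrow> ereal y < D \<Longrightarrow> continuous_on {..y} (Cfun a b)"
proof -
  assume y: "0 \<le> y" "ereal y < D"
  have int: "set_integrable lborel {0..x} (\<lambda>x. b x / a x)" if "x \<le> y" for x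
  proof -
    have "{0..x} \<subseteq> closed_dom D"
      using below_D[OF that y(2)] by (rule Icc_subset_closed_dom)
    then show ?thesis
      by (rule locally_integrable_onD[OF drift_int compact_Icc])
  qed
  have "continuous_on {0..y} (\<lambda>x. integral {0..x} (\<lambda>x. b x / a x))"
    by (rule indefinite_integral_continuous_1[OF set_borel_integral_eq_integral(1)[OF int]]) simp
  then have 1: "continuous_on {0..y} (Cfun a b)"
    by (rule continuous_on_eq)
       (simp add: Cfun_def set_borel_integral_eq_integral(2)[OF int])
  have 2: "continuous_on {..0} (Cfun a b)"
  proof (rule continuous_on_eq)
    show "continuous_on {..0::real} (\<lambda>_. 0::real)" by simp
    show "0 = Cfun a b x" if "x \<in> {..0}" for x
    proof (cases "x < 0")
      case True then show ?thesis by (simp add: Cfun_def set_lebesgue_integral_def)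
    next
      case False
      then have "x = 0" using that by simp
      then show ?thesis
        using set_borel_integral_eq_integral(2)[OF int[of 0]] y by (simp add: Cfun_def)
    qed
  qed
  have "continuous_on ({..0} \<union> {0..y}) (Cfun a b)"
    by (intro continuous_on_closed_Un 1 2) auto
  moreover have "{..0} \<union> {0..y} = {..y}" using y by auto
  ultimately show ?thesis by simp
qed

lemma open_below_D: "open {x. ereal x < D}"
proof -
  have "{x. ereal x < D} = einterval (-\<infinity>) D" by (auto simp: einterval_def)
  then show ?thesis by simp
qed

lemma isCont_r: assumes "ereal x < D" shows "isCont r x"
proof -
  have "max (ereal x) 0 < D" using assms D_pos by simp
  then obtain y where y: "max (ereal x) 0 < ereal y" "ereal y < D"
    using ereal_dense2 by blast
  then have yy: "x < y" "0 \<le> y" by auto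
  have "continuous_on {..y} (\<lambda>x. exp (- Cfun a b x))"
    by (intro continuous_intros continuous_Cfun yy y)
  moreover have "exp (- Cfun a b t) = r t" if "t \<in> {..y}" for t
  proof -
    have "ereal t < D" using that y(2) by (auto intro: below_D[of t y])
    then show ?thesis by (simp add: r_def)
  qed
  ultimately have "continuous_on {..y} r"
    by (rule continuous_on_eq)
  then show ?thesis
    using yy by (intro continuous_on_interior[of "{..y}"]) auto
qed

lemma continuous_on_r: "continuous_on {x. ereal x < D} r"
  by (intro continuous_at_imp_continuous_on) (auto intro: isCont_r)

lemma r_measurable [measurable]: "r \<in> borel_measurable borel"
proof -
  have "{x. ereal x < D} \<in> sets borel" using open_below_D by (rule borel_open)
  then have "(\<lambda>x. if x \<in> {x. ereal x < D} then r x else 1) \<in> borel_measurable borel"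
    by (intro borel_measurable_continuous_on_if continuous_on_r) auto
  moreover have "(\<lambda>x. if x \<in> {x. ereal x < D} then r x else 1) = r"
    by (auto simp: r_def)
  ultimately show ?thesis by simp
qed

lemma closed_dom_borel [measurable]: "closed_dom D \<in> sets borel"
  unfolding closed_dom_def by measurable

lemma a_dom_measurable [measurable]:
  "(\<lambda>x. indicator (einterval 0 D) x * a x) \<in> borel_measurable borel"
proof -
  have [measurable]: "(\<lambda>x. indicator (closed_dom D) x * a x) \<in> borel_measurable borel"
    using a_meas by (subst (asm) borel_measurable_restrict_space_iff) auto
  have "(\<lambda>x. indicator (einterval 0 D) x * (indicator (closed_dom D) x * a x)) \<in> borel_measurable borel"
    by measurable
  moreover have "(\<lambda>x. indicator (einterval 0 D) x * (indicator (closed_dom D) x * a x))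
      = (\<lambda>x. indicator (einterval 0 D) x * a x)"
    by (auto simp: fun_eq_iff mem_dom closed_dom_def split: split_indicator)
  ultimately show ?thesis by simp
qed

text \<open>
  Only the restriction of \<open>a\<close> to \<open>[0, D]\<close> is measurable; this form of \<open>m\<close> uses globally measurable
  functions.
\<close>

lemma m_eq: "m x = indicator (einterval 0 D) x / (r x * (indicator (einterval 0 D) x * a x))"
  by (auto simp: m_def r_def mem_dom exp_minus field_simps split: split_indicator)

lemma m_measurable [measurable]: "m \<in> borel_measurable borel"
  unfolding m_eq[abs_def] by measurable

lemma M_eq: "M = density lborel (\<lambda>x. ennreal (m x))"
  unfolding mu_def
  by (rule arg_cong[where f="density lborel"]) (auto simp: m_def fun_eq_iff split: split_indicator)

lemma N_eq: "N = density lborel (\<lambda>x. ennreal (r x) * indicator (einterval 0 D) x)"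
  unfolding nu_def
  by (rule arg_cong[where f="density lborel"])
     (auto simp: r_def fun_eq_iff mem_dom split: split_indicator)

lemma sets_M [measurable_cong, simp]: "sets M = sets borel" and space_M [simp]: "space M = UNIV"
  by (simp_all add: M_eq)

lemma sets_N [measurable_cong, simp]: "sets N = sets borel" and space_N [simp]: "space N = UNIV"
  by (simp_all add: N_eq)

lemma sigma_finite_M: "sigma_finite_measure M"
  unfolding M_eq by (subst sigma_finite_measure.sigma_finite_iff_density_finite[OF sigma_finite_lborel]) auto

lemma sigma_finite_N: "sigma_finite_measure N"
  unfolding N_eq
  by (subst sigma_finite_measure.sigma_finite_iff_density_finite[OF sigma_finite_lborel]) (auto split: split_indicator)

lemmas swap_tails = nn_integral_swap_tails[OF sigma_finite_M sigma_finite_N sets_M sets_N]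

lemma AE_M: "AE x in M. x \<in> einterval 0 D"
  unfolding M_eq by (subst AE_density) (measurable, simp add: m_def)

lemma AE_N: "AE x in N. x \<in> einterval 0 D"
  unfolding N_eq by (subst AE_density) (auto split: split_indicator)

lemma AE_M_neq: "AE x in M. x \<noteq> c"
  unfolding M_eq by (subst AE_density) (use AE_lborel_singleton[of c] in auto)

lemma AE_N_neq: "AE x in N. x \<noteq> c"
  unfolding N_eq by (subst AE_density) (use AE_lborel_singleton[of c] in auto)

lemma nn_integral_M_pos:
  assumes "0 \<le> u" "u < v" "ereal v \<le> D" "g \<in> borel_measurable borel"
    and "\<And>x. u < x \<Longrightarrow> x < v \<Longrightarrow> 0 < g x"
  shows "0 < (\<integral>\<^sup>+x\<in>{u<..<v}. g x \<partial>M)"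
  unfolding M_eq
proof (rule nn_integral_density_lborel_pos)
  fix x assume "u < x" "x < v"
  then have "ereal x < D" using assms(3) by (auto intro: below_D')
  with \<open>u < x\<close> \<open>x < v\<close> show "0 < ennreal (m x) \<and> 0 < g x" using assms by (auto intro!: m_pos simp: mem_dom)
qed (use assms in auto)

lemma nn_integral_N_pos:
  assumes "0 \<le> u" "u < v" "ereal v \<le> D" "g \<in> borel_measurable borel"
    and "\<And>x. u < x \<Longrightarrow> x < v \<Longrightarrow> 0 < g x"
  shows "0 < (\<integral>\<^sup>+x\<in>{u<..<v}. g x \<partial>N)"
  unfolding N_eq
proof (rule nn_integral_density_lborel_pos)
  fix x assume "u < x" "x < v"
  then have "ereal x < D" using assms(3) by (auto intro: below_D')
  with \<open>u < x\<close> \<open>x < v\<close> show "0 < ennreal (r x) * indicator (einterval 0 D) x \<and> 0 < g x"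
    using assms by (auto simp: mem_dom)
qed (use assms in auto)

lemma M_finite: assumes "ereal x < D" shows "emeasure M {..<x} < \<infinity>"
proof -
  have int: "set_integrable lborel {0..x} (\<lambda>x. exp (Cfun a b x) / a x)"
    by (rule locally_integrable_onD[OF speed_int compact_Icc Icc_subset_closed_dom[OF assms]])
  have "emeasure M {..<x} = (\<integral>\<^sup>+t. ennreal (m t) * indicator {..<x} t \<partial>lborel)"
    by (simp add: M_eq emeasure_density)
  also have "\<dots> \<le> (\<integral>\<^sup>+t. ennreal (norm (indicator {0..x} t *\<^sub>R (exp (Cfun a b t) / a t))) \<partial>lborel)"
  proof (rule nn_integral_mono)
    fix t
    show "ennreal (m t) * indicator {..<x} t \<le> ennreal (norm (indicator {0..x} t *\<^sub>R (exp (Cfun a b t) / a t)))"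
    proof (cases "t \<in> einterval 0 D \<and> t < x")
      case True
      then have "t \<in> {0..x}" "0 < a t" using a_pos by (auto simp: mem_dom)
      with True show ?thesis by (simp add: m_def)
    qed (auto simp: m_def)
  qed
  also have "\<dots> < \<infinity>"
    using int unfolding set_integrable_def integrable_iff_bounded by simp
  finally show ?thesis .
qed

lemma N_finite: assumes "ereal x < D" shows "emeasure N {..<x} < \<infinity>"
proof -
  have below: "ereal t < D" if "t \<le> x" for t
    using that assms by (rule below_D)
  have "compact (r ` {0..x})"
    by (intro compact_continuous_image continuous_on_subset[OF continuous_on_r]) (use below in auto)
  then obtain B where B: "\<And>t. t \<in> {0..x} \<Longrightarrow> r t \<le> B"
    by (meson bdd_above_def bounded_imp_bdd_above compact_imp_bounded imageI)
  have "emeasure N {..<x} = (\<integral>\<^sup>+t. ennreal (r t) * indicator (einterval 0 D) t * indicator {..<x} t \<partial>lborel)"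
    by (simp add: N_eq emeasure_density)
  also have "\<dots> \<le> (\<integral>\<^sup>+t. ennreal B * indicator {0..x} t \<partial>lborel)"
    by (intro nn_integral_mono) (use B in \<open>auto simp: mem_dom ennreal_leI split: split_indicator\<close>)
  also have "\<dots> < \<infinity>"
    by (subst nn_integral_cmult_indicator) (auto simp: ennreal_mult_less_top emeasure_lborel_Icc_eq)
  finally show ?thesis .
qed

lemma nn_integral_N:
  assumes A: "A \<in> sets borel" "A \<subseteq> einterval 0 D" and [measurable]: "h \<in> borel_measurable borel"
    and "\<And>s. s \<in> A \<Longrightarrow> 0 \<le> h s"
  shows "(\<integral>\<^sup>+s\<in>A. ennreal (h s) \<partial>N) = (\<integral>\<^sup>+s\<in>A. ennreal (h s * r s) \<partial>lborel)"
proof -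
  have [measurable]: "A \<in> sets borel" by fact
  have "(\<integral>\<^sup>+s\<in>A. ennreal (h s) \<partial>N)
      = (\<integral>\<^sup>+s. ennreal (r s) * indicator (einterval 0 D) s * (ennreal (h s) * indicator A s) \<partial>lborel)"
    unfolding N_eq by (subst nn_integral_density) auto
  also have "\<dots> = (\<integral>\<^sup>+s\<in>A. ennreal (h s * r s) \<partial>lborel)"
  proof (rule nn_integral_cong)
    fix s
    show "ennreal (r s) * indicator (einterval 0 D) s * (ennreal (h s) * indicator A s)
        = ennreal (h s * r s) * indicator A s"
    proof (cases "s \<in> A")
      case True
      then have "s \<in> einterval 0 D" using A(2) by blast
      then show ?thesis using True assms(4) by (simp add: ennreal_mult' mult.commute)
    qed simp
  qed
  finally show ?thesis .
qed

text \<open>The form only sees \<open>f'\<close> almost everywhere, and in terms of \<open>\<nu>\<close> it is \<open>\<integral> (f' e\<^sup>C)\<^sup>2 d\<nu>\<close>.\<close>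

lemma dirichlet_eq:
  assumes [measurable]: "d \<in> borel_measurable borel"
    and d: "AE x in lborel. x \<in> einterval 0 D \<longrightarrow> deriv f x = d x"
  shows "dirichlet a b D f = (\<integral>\<^sup>+x. ennreal ((d x / r x)\<^sup>2) \<partial>N)"
proof -
  have "dirichlet a b D f = (\<integral>\<^sup>+x. ennreal (indicator (einterval 0 D) x * a x * (d x)\<^sup>2) \<partial>M)"
    unfolding dirichlet_def
  proof (rule nn_integral_cong_AE)
    show "AE x in M. ennreal (a x * (deriv f x)\<^sup>2) = ennreal (indicator (einterval 0 D) x * a x * (d x)\<^sup>2)"
      unfolding M_eq
    proof (subst AE_density)
      show "AE x in lborel. 0 < ennreal (m x) \<longrightarrow>
          ennreal (a x * (deriv f x)\<^sup>2) = ennreal (indicator (einterval 0 D) x * a x * (d x)\<^sup>2)"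
        using d by eventually_elim (auto simp: m_def)
    qed simp
  qed
  also have "\<dots> = (\<integral>\<^sup>+x. ennreal (m x) * ennreal (indicator (einterval 0 D) x * a x * (d x)\<^sup>2) \<partial>lborel)"
    unfolding M_eq by (rule nn_integral_density) auto
  also have "\<dots> = (\<integral>\<^sup>+x. ennreal (r x) * indicator (einterval 0 D) x * ennreal ((d x / r x)\<^sup>2) \<partial>lborel)"
  proof (rule nn_integral_cong)
    fix x
    show "ennreal (m x) * ennreal (indicator (einterval 0 D) x * a x * (d x)\<^sup>2)
      = ennreal (r x) * indicator (einterval 0 D) x * ennreal ((d x / r x)\<^sup>2)"
    proof (cases "x \<in> einterval 0 D")
      case True
      then have "0 < a x" using a_pos by auto
      then have "m x * (a x * (d x)\<^sup>2) = r x * (d x / r x)\<^sup>2"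
        using True by (simp add: m_eq power2_eq_square field_simps)
      then show ?thesis using True by (simp flip: ennreal_mult')
    qed simp
  qed
  also have "\<dots> = (\<integral>\<^sup>+x. ennreal ((d x / r x)\<^sup>2) \<partial>N)"
    unfolding N_eq by (rule nn_integral_density[symmetric]) auto
  finally show ?thesis .
qed

section \<open>The double integral operator\<close>

definition left_mass :: "(real \<Rightarrow> real) \<Rightarrow> real \<Rightarrow> ennreal" where
  "left_mass f s = (\<integral>\<^sup>+u\<in>{..<s}. ennreal (f u) \<partial>M)"

definition tail :: "(real \<Rightarrow> ennreal) \<Rightarrow> real \<Rightarrow> ennreal" where
  "tail g x = (\<integral>\<^sup>+s\<in>{x<..}. g s \<partial>N)"

lemma left_mass_measurable [measurable]:
  "f \<in> borel_measurable borel \<Longrightarrow> left_mass f \<in> borel_measurable borel"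
  unfolding left_mass_def[abs_def]
  by (rule borel_measurable_left_tail[OF sigma_finite_M sets_M]) measurable

lemma tail_measurable [measurable]:
  "g \<in> borel_measurable borel \<Longrightarrow> tail g \<in> borel_measurable borel"
  unfolding tail_def[abs_def] by (rule borel_measurable_right_tail[OF sigma_finite_N sets_N])

lemma nn_integral_mult_tail:
  assumes [measurable]: "f \<in> borel_measurable borel" "g \<in> borel_measurable borel"
  shows "(\<integral>\<^sup>+x. ennreal (f x) * tail g x \<partial>M) = (\<integral>\<^sup>+s. g s * left_mass f s \<partial>N)"
  unfolding tail_def left_mass_def by (rule swap_tails) measurable

lemma left_mass_einterval:
  "(\<integral>\<^sup>+u\<in>einterval 0 (ereal s). ennreal (f u) \<partial>M) = left_mass f s"
  unfolding left_mass_def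
  by (rule nn_integral_cong_AE, use AE_M in eventually_elim)
     (auto simp: einterval_def split: split_indicator)

text \<open>
  Here \<open>f\<close> may vanish somewhere in \<open>(0, D)\<close>, as the localised functions do.
\<close>

lemma II_eq: "II a b D f x = tail (\<lambda>s. left_mass f s * indicator {s. f s \<noteq> 0} s) x / ennreal (f x)"
proof -
  have "(\<integral>\<^sup>+s\<in>einterval x D \<inter> {s. f s \<noteq> 0}. left_mass f s \<partial>N)
      = tail (\<lambda>s. left_mass f s * indicator {s. f s \<noteq> 0} s) x"
    unfolding tail_def
    by (rule nn_integral_cong_AE, use AE_N in eventually_elim)
       (auto simp: einterval_def split: split_indicator)
  then show ?thesis by (simp add: II_def left_mass_einterval)
qed

lemma left_mass_mono: "s \<le> t \<Longrightarrow> left_mass f s \<le> left_mass f t"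
  unfolding left_mass_def by (intro nn_integral_mono) (auto split: split_indicator)

lemma left_mass_le:
  assumes "g \<in> borel_measurable borel"
    and "\<And>x. x \<in> einterval 0 D \<Longrightarrow> x < s \<Longrightarrow> ennreal (f x) \<le> c * ennreal (g x)"
  shows "left_mass f s \<le> c * left_mass g s"
proof -
  have "left_mass f s \<le> (\<integral>\<^sup>+u. c * (ennreal (g u) * indicator {..<s} u) \<partial>M)"
    unfolding left_mass_def
    by (rule nn_integral_mono_AE, use AE_M in eventually_elim)
       (use assms(2) in \<open>auto split: split_indicator\<close>)
  also have "\<dots> = c * left_mass g s"
    unfolding left_mass_def by (rule nn_integral_cmult) (use assms(1) in measurable)
  finally show ?thesis .
qed

lemma tail_le:
  assumes "h \<in> borel_measurable borel"
    and "\<And>s. s \<in> einterval 0 D \<Longrightarrow> x < s \<Longrightarrow> g s \<le> c * h s"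
  shows "tail g x \<le> c * tail h x"
proof -
  have "tail g x \<le> (\<integral>\<^sup>+s. c * (h s * indicator {x<..} s) \<partial>N)"
    unfolding tail_def
    by (rule nn_integral_mono_AE, use AE_N in eventually_elim)
       (use assms(2) in \<open>auto split: split_indicator\<close>)
  also have "\<dots> = c * tail h x"
    unfolding tail_def by (rule nn_integral_cmult) (use assms(1) in measurable)
  finally show ?thesis .
qed

lemma tail_cong: "(\<And>s. s \<in> einterval 0 D \<Longrightarrow> x < s \<Longrightarrow> g s = h s) \<Longrightarrow> tail g x = tail h x"
  unfolding tail_def
  by (rule nn_integral_cong_AE, use AE_N in eventually_elim) (auto split: split_indicator)

lemma tail_antimono: "x \<le> y \<Longrightarrow> tail g y \<le> tail g x"
  unfolding tail_def by (intro nn_integral_mono) (auto split: split_indicator)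

definition positive :: "(real \<Rightarrow> real) \<Rightarrow> bool" where
  "positive f \<longleftrightarrow> f \<in> borel_measurable borel \<and> (\<forall>x\<in>einterval 0 D. 0 < f x)"

lemma positiveD: "positive f \<Longrightarrow> x \<in> einterval 0 D \<Longrightarrow> 0 < f x"
  by (simp add: positive_def)

lemma positive_mult_II:
  assumes "positive f" "x \<in> einterval 0 D"
  shows "II a b D f x = tail (left_mass f) x / ennreal (f x)"
    and "ennreal (f x) * II a b D f x = tail (left_mass f) x"
proof -
  show 1: "II a b D f x = tail (left_mass f) x / ennreal (f x)"
    unfolding II_eq using assms
    by (intro arg_cong2[where f="(/)"] tail_cong refl) (simp add: positiveD less_imp_neq[symmetric])
  show "ennreal (f x) * II a b D f x = tail (left_mass f) x"
    unfolding 1 using positiveD[OF assms]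
    by (simp add: ennreal_times_divide mult_divide_eq_ennreal mult.commute[of "ennreal (f x)"])
qed

lemma left_mass_pos: "positive f \<Longrightarrow> s \<in> einterval 0 D \<Longrightarrow> 0 < left_mass f s"
proof -
  assume f: "positive f" and s: "s \<in> einterval 0 D"
  have "0 < (\<integral>\<^sup>+x\<in>{0<..<s}. ennreal (f x) \<partial>M)"
  proof (rule nn_integral_M_pos)
    fix x assume "0 < x" "x < s"
    then have "x \<in> einterval 0 D" using s below_D[of x s] by (auto simp: mem_dom)
    then show "0 < ennreal (f x)" using f by (auto simp: positive_def)
  qed (use f s in \<open>auto simp: positive_def mem_dom less_imp_le\<close>)
  also have "\<dots> \<le> left_mass f s"
    unfolding left_mass_def by (intro nn_integral_mono) (auto split: split_indicator)
  finally show ?thesis .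
qed

lemma tail_left_mass_pos: "positive f \<Longrightarrow> x \<in> einterval 0 D \<Longrightarrow> 0 < tail (left_mass f) x"
proof -
  assume f: "positive f" and x: "x \<in> einterval 0 D"
  have [measurable]: "f \<in> borel_measurable borel" using f by (simp add: positive_def)
  have "0 < x" "ereal x < D" using x by (auto simp: mem_dom)
  then obtain v where v: "ereal x < ereal v" "ereal v < D" using ereal_dense2 by blast
  have "0 < (\<integral>\<^sup>+s\<in>{x<..<v}. left_mass f s \<partial>N)"
  proof (rule nn_integral_N_pos)
    fix s assume s: "x < s" "s < v"
    then have "s \<in> einterval 0 D" using \<open>0 < x\<close> below_D[of s v] v(2) by (auto simp: mem_dom)
    then show "0 < left_mass f s" by (rule left_mass_pos[OF f])
  qed (use \<open>0 < x\<close> v in auto)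
  also have "\<dots> \<le> tail (left_mass f) x"
    unfolding tail_def by (intro nn_integral_mono) (auto split: split_indicator)
  finally show ?thesis .
qed

text \<open>
  The left mass is increasing in its endpoint, so an infinite value at \<open>s\<close> would make the whole tail
  beyond \<open>s\<close> infinite.
\<close>

lemma left_mass_finite:
  assumes f: "positive f" and s: "s \<in> einterval 0 D" and fin: "tail (left_mass f) s < \<infinity>"
  shows "left_mass f s < \<infinity>"
proof -
  have "0 < s" "ereal s < D" using s by (auto simp: mem_dom)
  then obtain v where v: "ereal s < ereal v" "ereal v < D" using ereal_dense2 by blast
  have "left_mass f s * emeasure N {s<..<v} = (\<integral>\<^sup>+t\<in>{s<..<v}. left_mass f s \<partial>N)"
    by (simp add: nn_integral_cmult_indicator)
  also have "\<dots> \<le> tail (left_mass f) s"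
    unfolding tail_def
    by (intro nn_integral_mono) (auto simp: left_mass_mono split: split_indicator)
  finally have "left_mass f s * emeasure N {s<..<v} \<le> tail (left_mass f) s" .
  moreover have "0 < (\<integral>\<^sup>+t\<in>{s<..<v}. 1 \<partial>N)"
    by (rule nn_integral_N_pos) (use \<open>0 < s\<close> v in auto)
  ultimately show ?thesis
    using fin
    by (cases "left_mass f s = top")
       (auto simp: ennreal_top_mult top_unique less_top split: if_splits)
qed

section \<open>Positive supersolutions bound the eigenvalue from below\<close>

text \<open>
  The Dirichlet condition at \<open>D\<close> in a form common to both cases: for finite \<open>D\<close> it is continuity up to the
  endpoint, for \<open>D = \<infinity>\<close> it comes from the compact support.
\<close>

lemma test_function_vanishes_at_D:
  assumes f: "f \<in> C_K D" and fD: "D < \<infinity> \<longrightarrow> f (real_of_ereal D) = 0"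
    and x: "x \<in> einterval 0 D" and "0 < e"
  obtains y where "x < y" "y \<in> einterval 0 D" "\<bar>f y\<bar> < e"
proof (cases "D = \<infinity>")
  case True
  let ?S = "closure {x \<in> closed_dom D. f x \<noteq> 0}"
  have "bounded ?S" using f by (auto simp: C_K_def intro: compact_imp_bounded)
  then obtain B where B: "\<And>t. t \<in> ?S \<Longrightarrow> \<bar>t\<bar> \<le> B" unfolding bounded_iff by auto
  define y where "y = max x B + 1"
  have "x < y" "B < y" by (auto simp: y_def)
  have y: "y \<in> einterval 0 D" using x \<open>x < y\<close> True by (simp add: einterval_def)
  have "f y = 0"
  proof (rule ccontr)
    assume "f y \<noteq> 0"
    with y have "y \<in> {x \<in> closed_dom D. f x \<noteq> 0}"
      by (auto simp: closed_dom_def mem_dom less_imp_le)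
    then have "y \<in> ?S" by (rule subsetD[OF closure_subset])
    from B[OF this] \<open>B < y\<close> show False by linarith
  qed
  then show ?thesis using that[of y] y \<open>x < y\<close> \<open>0 < e\<close> by simp
next
  case False
  then obtain d where d: "D = ereal d" using D_pos by (cases D) auto
  then have dom: "closed_dom D = {0..d}" by (auto simp: closed_dom_def)
  have xd: "0 < x" "x < d" using x d by (auto simp: einterval_def)
  have "continuous_on {0..d} f" "f d = 0" using f fD d dom by (auto simp: C_K_def)
  from this(1)[unfolded continuous_on_iff, rule_format, of d e]
  have "\<exists>\<delta>>0. \<forall>t\<in>{0..d}. dist t d < \<delta> \<longrightarrow> dist (f t) (f d) < e"
    using \<open>0 < e\<close> xd by simp
  then obtain \<delta> where \<delta>: "0 < \<delta>" "\<And>t. t \<in> {0..d} \<Longrightarrow> \<bar>t - d\<bar> < \<delta> \<Longrightarrow> \<bar>f t\<bar> < e"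
    using \<open>f d = 0\<close> by (auto simp: dist_real_def)
  have "max x (d - \<delta>) < d" using xd \<delta> by simp
  then obtain y where y: "max x (d - \<delta>) < y" "y < d" using dense by blast
  show ?thesis
    using that[of y] y xd \<delta>(2)[of y] d by (auto simp: einterval_def)
qed

lemma antiderivative_on_dom:
  fixes g :: "real \<Rightarrow> real"
  assumes "continuous_on (einterval 0 D) g"
  obtains G where "\<And>x. x \<in> einterval 0 D \<Longrightarrow> (G has_real_derivative g x) (at x)"
proof -
  have "isCont g x" if "0 < ereal x" "ereal x < D" for x
    using assms that continuous_on_eq_continuous_at[OF open_einterval, of 0 D g]
    by (auto simp: einterval_def)
  then obtain G where "\<forall>x::real. 0 < ereal x \<longrightarrow> ereal x < D \<longrightarrow> (G has_vector_derivative g x) (at x)"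
    using einterval_antiderivative[OF D_pos, of g] by blast
  then show ?thesis
    using that[of G] by (simp add: einterval_def has_real_derivative_iff_has_vector_derivative)
qed

lemma nn_integral_N_FTC:
  assumes "u \<in> einterval 0 D" "v \<in> einterval 0 D" "u \<le> v" and [measurable]: "g \<in> borel_measurable borel"
    and "\<And>s. u \<le> s \<Longrightarrow> s \<le> v \<Longrightarrow> 0 \<le> g s"
    and "\<And>s. u \<le> s \<Longrightarrow> s \<le> v \<Longrightarrow> (G has_real_derivative g s * r s) (at s)"
  shows "(\<integral>\<^sup>+s\<in>{u..v}. ennreal (g s) \<partial>N) = ennreal (G v - G u)"
proof -
  have "(\<integral>\<^sup>+s\<in>{u..v}. ennreal (g s) \<partial>N) = (\<integral>\<^sup>+s\<in>{u..v}. ennreal (g s * r s) \<partial>lborel)"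
  proof (rule nn_integral_N)
    show "{u..v} \<subseteq> einterval 0 D"
    proof
      fix s assume "s \<in> {u..v}"
      then show "s \<in> einterval 0 D" using assms(1,2) below_D[of s v] by (auto simp: mem_dom)
    qed
  qed (use assms in auto)
  also have "\<dots> = ennreal (G v - G u)"
    by (rule nn_integral_FTC_Icc) (use assms in auto)
  finally show ?thesis .
qed

text \<open>
  Comparison of \<open>f\<close> with an antiderivative of \<open>\<bar>f'\<bar>\<close> bounds the increments of \<open>f\<close> on compact
  intervals, even if \<open>f'\<close> is not integrable up to the endpoints of \<open>(0, D)\<close>.
\<close>

lemma test_function_le_tail:
  assumes f: "f \<in> C_K D" and fD: "D < \<infinity> \<longrightarrow> f (real_of_ereal D) = 0"
    and [measurable]: "d \<in> borel_measurable borel" and d: "continuous_on (einterval 0 D) d"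
    and deriv: "\<And>x. x \<in> einterval 0 D \<Longrightarrow> (f has_real_derivative d x) (at x)"
    and x: "x \<in> einterval 0 D"
  shows "ennreal \<bar>f x\<bar> \<le> tail (\<lambda>s. ennreal (\<bar>d s\<bar> / r s)) x"
proof (rule ennreal_le_epsilon)
  fix e :: real assume "0 < e"
  then obtain y where y: "x < y" "y \<in> einterval 0 D" "\<bar>f y\<bar> < e"
    using test_function_vanishes_at_D[OF f fD x] by blast
  have dom: "s \<in> einterval 0 D" if "x \<le> s" "s \<le> y" for s
    using that x y(2) below_D[of s y] by (auto simp: mem_dom)
  have "continuous_on (einterval 0 D) (\<lambda>x. \<bar>d x\<bar>)" using d by (intro continuous_intros)
  then obtain A where A: "\<And>x. x \<in> einterval 0 D \<Longrightarrow> (A has_real_derivative \<bar>d x\<bar>) (at x)"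
    using antiderivative_on_dom by blast
  \<comment> \<open>A has derivative equal to the absolute value of f', so A - f and A + f are both increasing\<close>
  have "A x - f x \<le> A y - f y"
    by (rule DERIV_nonneg_imp_nondecreasing)
       (use y dom in \<open>auto intro!: exI derivative_eq_intros A deriv\<close>)
  moreover have "A x + f x \<le> A y + f y"
    by (rule DERIV_nonneg_imp_nondecreasing)
       (use y dom in \<open>auto intro!: exI derivative_eq_intros A deriv\<close>)
  ultimately have 1: "\<bar>f x\<bar> \<le> (A y - A x) + e" using y(3) by linarith
  have 2: "(\<integral>\<^sup>+s\<in>{x..y}. ennreal (\<bar>d s\<bar> / r s) \<partial>N) = ennreal (A y - A x)"
    by (rule nn_integral_N_FTC) (use x y dom A in auto)
  have 3: "(\<integral>\<^sup>+s\<in>{x..y}. ennreal (\<bar>d s\<bar> / r s) \<partial>N) \<le> tail (\<lambda>s. ennreal (\<bar>d s\<bar> / r s)) x"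
    unfolding tail_def
    by (rule nn_integral_mono_AE, use AE_N_neq[of x] in eventually_elim) (auto split: split_indicator)
  have "A x \<le> A y"
    by (rule DERIV_nonneg_imp_nondecreasing) (use y dom in \<open>auto intro!: exI A\<close>)
  with 1 \<open>0 < e\<close> have "ennreal \<bar>f x\<bar> \<le> ennreal (A y - A x) + ennreal e"
    by (simp flip: ennreal_plus)
  also have "\<dots> \<le> tail (\<lambda>s. ennreal (\<bar>d s\<bar> / r s)) x + ennreal e"
    using 3 unfolding 2 by (rule add_right_mono)
  finally show "ennreal \<bar>f x\<bar> \<le> tail (\<lambda>s. ennreal (\<bar>d s\<bar> / r s)) x + ennreal e" .
qed

lemma C_K_derivative:
  assumes "f \<in> C_K D"
  obtains d where "d \<in> borel_measurable borel" "continuous_on (einterval 0 D) d"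
    "\<And>x. x \<in> einterval 0 D \<Longrightarrow> (f has_real_derivative d x) (at x)"
    "dirichlet a b D f = (\<integral>\<^sup>+x. ennreal ((d x / r x)\<^sup>2) \<partial>N)"
proof -
  obtain d where d: "\<And>x. x \<in> einterval 0 D \<Longrightarrow> (f has_vector_derivative d x) (at x)"
    "continuous_on (einterval 0 D) d"
    using assms unfolding C_K_def C1_differentiable_on_def by blast
  define d0 where "d0 x = (if x \<in> einterval 0 D then d x else 0)" for x
  have 1: "d0 \<in> borel_measurable borel"
    unfolding d0_def[abs_def] by (intro borel_measurable_continuous_on_if d(2)) auto
  have 2: "continuous_on (einterval 0 D) d0"
    by (rule continuous_on_eq[OF d(2)]) (simp add: d0_def)
  have 3: "(f has_real_derivative d0 x) (at x)" if "x \<in> einterval 0 D" for x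
    using d(1)[OF that] that by (simp add: has_real_derivative_iff_has_vector_derivative d0_def)
  have 4: "dirichlet a b D f = (\<integral>\<^sup>+x. ennreal ((d0 x / r x)\<^sup>2) \<partial>N)"
    by (rule dirichlet_eq[OF 1]) (auto intro!: AE_I2 DERIV_imp_deriv[OF 3])
  show ?thesis by (rule that[OF 1 2 3 4])
qed

text \<open>
  The heart of the lower bounds. The weight \<open>H = left_mass g\<close> in the Cauchy--Schwarz inequality
  serves two purposes: its tail is \<open>g II(g) \<le> c g\<close>, and after the exchange of integrals the factor
  \<open>left_mass g\<close> that arises from this \<open>g\<close> cancels the \<open>1 / H\<close> in the other factor.
\<close>

lemma mu_sq_le_dirichlet:
  assumes g: "positive g" and "c < \<infinity>"
    and super: "\<And>x. x \<in> einterval 0 D \<Longrightarrow> tail (left_mass g) x \<le> c * ennreal (g x)"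
    and f: "f \<in> C_K D" and fD: "D < \<infinity> \<longrightarrow> f (real_of_ereal D) = 0"
  shows "mu_sq a b D f \<le> c * dirichlet a b D f"
proof -
  obtain d where d [measurable]: "d \<in> borel_measurable borel" and dc: "continuous_on (einterval 0 D) d"
    and deriv: "\<And>x. x \<in> einterval 0 D \<Longrightarrow> (f has_real_derivative d x) (at x)"
    and dir: "dirichlet a b D f = (\<integral>\<^sup>+x. ennreal ((d x / r x)\<^sup>2) \<partial>N)"
    using C_K_derivative[OF f] by blast
  have [measurable]: "g \<in> borel_measurable borel" using g by (simp add: positive_def)
  define H where "H s = enn2real (left_mass g s)" for s
  have [measurable]: "H \<in> borel_measurable borel" unfolding H_def[abs_def] by measurable
  have H: "left_mass g s = ennreal (H s)" "0 < H s" if s: "s \<in> einterval 0 D" for s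
  proof -
    have "tail (left_mass g) s < \<infinity>"
      by (rule order_le_less_trans[OF super[OF s]]) (use \<open>c < \<infinity>\<close> in \<open>simp add: ennreal_mult_less_top\<close>)
    then have "left_mass g s < top" "0 < left_mass g s"
      using left_mass_finite[OF g s] left_mass_pos[OF g s] by auto
    then show "left_mass g s = ennreal (H s)" "0 < H s"
      by (auto simp: H_def enn2real_positive_iff)
  qed
  define W where "W s = ennreal ((d s / r s)\<^sup>2 / H s)" for s
  have W [measurable]: "W \<in> borel_measurable borel" unfolding W_def[abs_def] by measurable
  have pointwise: "ennreal ((f x)\<^sup>2) \<le> c * (ennreal (g x) * tail W x)" if x: "x \<in> einterval 0 D" for x
  proof -
    let ?p = "\<lambda>s. ennreal (\<bar>d s\<bar> / r s / sqrt (H s)) * indicator {x<..} s"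
    let ?q = "\<lambda>s. ennreal (sqrt (H s)) * indicator {x<..} s"
    have "tail (\<lambda>s. ennreal (\<bar>d s\<bar> / r s)) x = (\<integral>\<^sup>+s. ?p s * ?q s \<partial>N)"
      unfolding tail_def
      by (rule nn_integral_cong_AE, use AE_N in eventually_elim)
         (use H(2) in \<open>fastforce simp flip: ennreal_mult' split: split_indicator\<close>)
    then have "(tail (\<lambda>s. ennreal (\<bar>d s\<bar> / r s)) x)\<^sup>2 \<le> (\<integral>\<^sup>+s. ?p s ^ 2 \<partial>N) * (\<integral>\<^sup>+s. ?q s ^ 2 \<partial>N)"
      using Cauchy_Schwarz_nn_integral[of ?p N ?q] by simp
    also have "(\<integral>\<^sup>+s. ?p s ^ 2 \<partial>N) = tail W x"
      unfolding tail_def W_def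
    proof (rule nn_integral_cong_AE, use AE_N in eventually_elim)
      fix s assume "s \<in> einterval 0 D"
      then show "?p s ^ 2 = ennreal ((d s / r s)\<^sup>2 / H s) * indicator {x<..} s"
        using H(2)[of s] by (auto simp: ennreal_power power_divide power_mult_distrib split: split_indicator)
    qed
    also have "(\<integral>\<^sup>+s. ?q s ^ 2 \<partial>N) = tail (left_mass g) x"
      unfolding tail_def
    proof (rule nn_integral_cong_AE, use AE_N in eventually_elim)
      fix s assume "s \<in> einterval 0 D"
      then show "?q s ^ 2 = left_mass g s * indicator {x<..} s"
        using H[of s] by (auto simp: ennreal_power split: split_indicator)
    qed
    also have "tail W x * tail (left_mass g) x \<le> tail W x * (c * ennreal (g x))"
      by (intro mult_left_mono super x) auto
    finally have "(tail (\<lambda>s. ennreal (\<bar>d s\<bar> / r s)) x)\<^sup>2 \<le> c * (ennreal (g x) * tail W x)"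
      by (simp add: ac_simps)
    moreover have "ennreal ((f x)\<^sup>2) \<le> (tail (\<lambda>s. ennreal (\<bar>d s\<bar> / r s)) x)\<^sup>2"
      using power_mono[OF test_function_le_tail[OF f fD d dc deriv x], of 2]
      by (simp add: ennreal_power)
    ultimately show ?thesis by order
  qed
  have "mu_sq a b D f \<le> (\<integral>\<^sup>+x. c * (ennreal (g x) * tail W x) \<partial>M)"
    unfolding mu_sq_def
    by (rule nn_integral_mono_AE, use AE_M in eventually_elim) (rule pointwise)
  also have "\<dots> = c * (\<integral>\<^sup>+x. ennreal (g x) * tail W x \<partial>M)"
    by (rule nn_integral_cmult) measurable
  also have "(\<integral>\<^sup>+x. ennreal (g x) * tail W x \<partial>M) = (\<integral>\<^sup>+s. W s * left_mass g s \<partial>N)"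
    by (rule nn_integral_mult_tail) measurable
  also have "\<dots> = dirichlet a b D f"
    unfolding dir
  proof (rule nn_integral_cong_AE, use AE_N in eventually_elim)
    fix s assume "s \<in> einterval 0 D"
    then show "W s * left_mass g s = ennreal ((d s / r s)\<^sup>2)"
      using H[of s] by (simp add: W_def flip: ennreal_mult')
  qed
  finally show ?thesis .
qed

lemma inverse_le_lambda0:
  assumes "positive g" "c < \<infinity>"
    and "\<And>x. x \<in> einterval 0 D \<Longrightarrow> tail (left_mass g) x \<le> c * ennreal (g x)"
  shows "inverse c \<le> lambda0 a b D"
  unfolding lambda0_def
proof (rule Inf_greatest, clarify)
  fix f assume f: "mu_sq a b D f = 1" "f \<in> C_K D" "D < \<infinity> \<longrightarrow> f (real_of_ereal D) = 0"
  then have 1: "1 \<le> c * dirichlet a b D f"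
    using mu_sq_le_dirichlet[OF assms, of f] by simp
  then have "c \<noteq> 0" by auto
  have "inverse c * 1 \<le> inverse c * (c * dirichlet a b D f)"
    by (rule mult_left_mono[OF 1]) simp
  also have "\<dots> = dirichlet a b D f"
    using \<open>c \<noteq> 0\<close> \<open>c < \<infinity>\<close> by (simp add: mult.assoc[symmetric] divide_ennreal_def[symmetric] mult.commute[of "inverse c"])
  finally show "inverse c \<le> dirichlet a b D f" by simp
qed

section \<open>The first approximating sequence\<close>

text \<open>
  As \<open>\<mu>\<close> and \<open>\<nu>\<close> are carried by \<open>(0, D)\<close>, half-lines can replace the intervals with an endpoint
  \<open>0\<close> or \<open>D\<close>.
\<close>

lemma emeasure_M_einterval: "emeasure M (einterval 0 (ereal x)) = emeasure M {..<x}"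
  by (rule emeasure_eq_AE, use AE_M in eventually_elim) (auto simp: einterval_def)

lemma emeasure_N_einterval: "emeasure N (einterval (ereal x) D) = emeasure N {x<..}"
  by (rule emeasure_eq_AE, use AE_N in eventually_elim) (auto simp: einterval_def)

lemma emeasure_M_pos: "x \<in> einterval 0 D \<Longrightarrow> 0 < emeasure M {..<x}"
proof -
  assume x: "x \<in> einterval 0 D"
  have "0 < (\<integral>\<^sup>+t\<in>{0<..<x}. 1 \<partial>M)"
    by (rule nn_integral_M_pos) (use x in \<open>auto simp: mem_dom less_imp_le\<close>)
  also have "\<dots> \<le> emeasure M {..<x}"
    by (simp, intro emeasure_mono) auto
  finally show ?thesis .
qed

lemma emeasure_N_pos: "0 \<le> x \<Longrightarrow> x < y \<Longrightarrow> ereal y \<le> D \<Longrightarrow> 0 < emeasure N {x<..<y}"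
  using nn_integral_N_pos[of x y "\<lambda>_. 1"] by simp

lemma hardy_bound:
  "x \<in> einterval 0 D \<Longrightarrow> emeasure M {..<x} * emeasure N {x<..} \<le> delta a b D"
  unfolding delta_def by (rule SUP_upper2) (auto simp: emeasure_M_einterval emeasure_N_einterval)

text \<open>
  One interior point suffices: near \<open>0\<close> the measure \<open>\<nu>\<close> is always finite, and \<open>\<mu>(0, x) > 0\<close> makes
  \<open>\<nu>(x, D)\<close> finite.
\<close>

lemma N_finite_UNIV:
  assumes "delta a b D < \<infinity>"
  shows "emeasure N UNIV < \<infinity>"
proof -
  obtain x y :: real where xy: "0 < x" "x < y" "ereal y < D"
  proof -
    obtain y where y: "0 < ereal y" "ereal y < D" using ereal_dense2[OF D_pos] by blast
    then show ?thesis using that[of "y/2" y] by auto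
  qed
  then have x: "x \<in> einterval 0 D" by (auto simp: mem_dom intro: below_D[of x y])
  have "emeasure N {x<..} < \<infinity>"
    using hardy_bound[OF x] emeasure_M_pos[OF x] assms
    by (cases "emeasure N {x<..} = top") (auto simp: ennreal_mult_top top_unique less_top split: if_splits)
  moreover have "emeasure N UNIV \<le> emeasure N {..<y} + emeasure N {x<..}"
    using xy by (intro order_trans[OF _ emeasure_subadditive] emeasure_mono) auto
  ultimately show ?thesis
    using N_finite[OF xy(3)] by (auto simp: less_top intro: order_le_less_trans)
qed

definition phi :: "real \<Rightarrow> real" where
  "phi x = measure N {x<..}"

lemma emeasure_N_Ioi_split:
  assumes "u \<le> v"
  shows "emeasure N {u<..} = emeasure N {u..v} + emeasure N {v<..}"
proof -
  have "emeasure N {u<..} = emeasure N ({u..v} \<union> {v<..})"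
    by (rule emeasure_eq_AE, use AE_N_neq[of u] in eventually_elim) (use assms in auto)
  also have "\<dots> = emeasure N {u..v} + emeasure N {v<..}"
    by (rule plus_emeasure[symmetric]) auto
  finally show ?thesis .
qed

context
  assumes delta_finite: "delta a b D < \<infinity>"
begin

lemma emeasure_phi: "emeasure N {x<..} = ennreal (phi x)"
proof -
  have "emeasure N {x<..} \<le> emeasure N UNIV" by (rule emeasure_mono) auto
  then have "emeasure N {x<..} < top" using N_finite_UNIV[OF delta_finite] by (auto intro: order_le_less_trans)
  then show ?thesis by (simp add: phi_def measure_def)
qed

lemma phi_pos: "x \<in> einterval 0 D \<Longrightarrow> 0 < phi x"
proof -
  assume x: "x \<in> einterval 0 D"
  then obtain y where y: "ereal x < ereal y" "ereal y < D" using ereal_dense2[of x D] by (auto simp: mem_dom)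
  have "0 < emeasure N {x<..<y}" using x y by (intro emeasure_N_pos) (auto simp: mem_dom)
  also have "\<dots> \<le> emeasure N {x<..}" by (rule emeasure_mono) auto
  finally show ?thesis by (simp add: emeasure_phi)
qed

lemma phi_antimono: "x \<le> y \<Longrightarrow> phi y \<le> phi x"
proof -
  assume "x \<le> y"
  then have "emeasure N {y<..} \<le> emeasure N {x<..}" by (intro emeasure_mono) auto
  then show ?thesis by (simp add: emeasure_phi phi_def)
qed

lemma phi_measurable [measurable]: "phi \<in> borel_measurable borel"
proof -
  have "phi = (\<lambda>x. enn2real (tail (\<lambda>_. 1) x))"
    by (simp add: fun_eq_iff phi_def measure_def tail_def)
  then show ?thesis by simp
qed

lemma phi_deriv: "x \<in> einterval 0 D \<Longrightarrow> (phi has_real_derivative - r x) (at x)"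
proof -
  assume x: "x \<in> einterval 0 D"
  have "continuous_on (einterval 0 D) r"
    by (rule continuous_on_subset[OF continuous_on_r]) (auto simp: einterval_def)
  then obtain R where R: "\<And>x. x \<in> einterval 0 D \<Longrightarrow> (R has_real_derivative r x) (at x)"
    using antiderivative_on_dom by blast
  have diff: "phi u - phi v = R v - R u" if "u \<in> einterval 0 D" "v \<in> einterval 0 D" "u \<le> v" for u v
  proof -
    have dom: "s \<in> einterval 0 D" if "u \<le> s" "s \<le> v" for s
      using that \<open>u \<in> _\<close> \<open>v \<in> _\<close> below_D[of s v] by (auto simp: mem_dom)
    have "emeasure N {u..v} = (\<integral>\<^sup>+s\<in>{u..v}. ennreal 1 \<partial>N)" by simp
    also have "\<dots> = ennreal (R v - R u)"
      by (rule nn_integral_N_FTC) (use that dom R in auto)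
    finally have "ennreal (phi u) = ennreal (R v - R u) + ennreal (phi v)"
      using emeasure_N_Ioi_split[OF \<open>u \<le> v\<close>] by (simp add: emeasure_phi)
    moreover have "R u \<le> R v"
      by (rule DERIV_nonneg_imp_nondecreasing) (use that dom R in \<open>auto intro!: exI[of _ "r _"]\<close>)
    ultimately show ?thesis by (simp add: phi_def flip: ennreal_plus)
  qed
  have "phi x + R x - R y = phi y" if "y \<in> einterval 0 D" for y
    using diff[OF x that] diff[OF that x] by (cases "x \<le> y") auto
  moreover have "((\<lambda>y. phi x + R x - R y) has_real_derivative - r x) (at x)"
    by (auto intro!: derivative_eq_intros R x)
  ultimately show ?thesis
    using has_field_derivative_transform_within_open[OF _ open_einterval x] by blast
qed

lemma sqrt_phi_deriv:
  assumes "x \<in> einterval 0 D"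
  shows "((\<lambda>t. sqrt (phi t)) has_real_derivative - (r x / (2 * sqrt (phi x)))) (at x)"
proof -
  have "((\<lambda>t. sqrt (phi t)) has_real_derivative inverse (sqrt (phi x)) / 2 * - r x) (at x)"
    by (rule DERIV_chain2[where f=sqrt and g=phi, OF DERIV_real_sqrt[OF phi_pos[OF assms]] phi_deriv[OF assms]])
  also have "inverse (sqrt (phi x)) / 2 * - r x = - (r x / (2 * sqrt (phi x)))"
    by (simp add: inverse_eq_divide)
  finally show ?thesis .
qed

lemma M_le_delta_div_phi:
  "x \<in> einterval 0 D \<Longrightarrow> emeasure M {..<x} \<le> ennreal (enn2real (delta a b D) / phi x)"
proof -
  assume x: "x \<in> einterval 0 D"
  have "emeasure M {..<x} = emeasure M {..<x} * ennreal (phi x) / ennreal (phi x)"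
    using phi_pos[OF x] by (simp add: mult_divide_eq_ennreal)
  also have "\<dots> \<le> delta a b D / ennreal (phi x)"
    using hardy_bound[OF x] by (intro divide_right_mono_ennreal) (simp add: emeasure_phi)
  also have "\<dots> = ennreal (enn2real (delta a b D) / phi x)"
    using delta_finite phi_pos[OF x] by (simp flip: divide_ennreal)
  finally show ?thesis .
qed

text \<open>
  For \<open>u < s\<close> write \<open>\<surd>\<phi>(u)\<close> as \<open>\<surd>\<phi>(s)\<close> plus the \<open>\<nu>\<close>-integral of \<open>1 / (2 \<surd>\<phi>)\<close> over
  \<open>(u, s)\<close>. Exchanging the integrals turns the second part into an integral of
  \<open>\<mu>(0, t) / (2 \<surd>\<phi>(t))\<close>, and \<open>\<mu>(0, t) \<le> \<delta> / \<phi>(t)\<close> leaves exactly the derivative of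
  \<open>\<delta> / \<surd>\<phi>\<close> with respect to \<open>\<nu>\<close>. Each part contributes at most \<open>\<delta> / \<surd>\<phi>(s)\<close>.
\<close>

lemma left_mass_sqrt_phi:
  assumes s: "s \<in> einterval 0 D"
  shows "left_mass (\<lambda>x. sqrt (phi x)) s \<le> ennreal (2 * enn2real (delta a b D) / sqrt (phi s))"
proof -
  let ?d = "enn2real (delta a b D)"
  define g where "g t = 1 / (2 * sqrt (phi t))" for t
  have g0 [simp]: "0 \<le> g t" for t by (simp add: g_def phi_def)
  have [measurable]: "g \<in> borel_measurable borel" unfolding g_def[abs_def] by measurable
  have dom: "t \<in> einterval 0 D" if "0 < t" "t \<le> s" for t
    using that s below_D[of t s] by (auto simp: mem_dom)
  let ?G = "\<lambda>t. ennreal (g t) * indicator {..<s} t"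
  have sqrt_eq: "ennreal (sqrt (phi u)) = ennreal (sqrt (phi s)) + tail ?G u" if u: "0 < u" "u < s" for u
  proof -
    have "tail ?G u = (\<integral>\<^sup>+t\<in>{u..s}. ennreal (g t) \<partial>N)"
      unfolding tail_def
      by (rule nn_integral_cong_AE, use AE_N_neq[of u] AE_N_neq[of s] in eventually_elim)
         (auto split: split_indicator)
    also have "\<dots> = ennreal (- sqrt (phi s) - - sqrt (phi u))"
    proof (rule nn_integral_N_FTC[where G="\<lambda>t. - sqrt (phi t)"])
      fix t assume "u \<le> t" "t \<le> s"
      then have t: "t \<in> einterval 0 D" using u dom by auto
      show "((\<lambda>t. - sqrt (phi t)) has_real_derivative g t * r t) (at t)"
        by (rule DERIV_cong[OF DERIV_minus[OF sqrt_phi_deriv[OF t]]]) (simp add: g_def)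
    qed (use u s dom in auto)
    finally show ?thesis
      using phi_antimono[of u s] u by (simp add: phi_def flip: ennreal_plus)
  qed
  have split: "left_mass (\<lambda>x. sqrt (phi x)) s
      = ennreal (sqrt (phi s)) * emeasure M {..<s} + (\<integral>\<^sup>+u. ennreal (indicator {..<s} u) * tail ?G u \<partial>M)"
  proof -
    have "left_mass (\<lambda>x. sqrt (phi x)) s
      = (\<integral>\<^sup>+u. ennreal (sqrt (phi s)) * indicator {..<s} u + ennreal (indicator {..<s} u) * tail ?G u \<partial>M)"
    unfolding left_mass_def
    by (rule nn_integral_cong_AE, use AE_M in eventually_elim)
       (auto simp: sqrt_eq mem_dom split: split_indicator)
    also have "\<dots> = ennreal (sqrt (phi s)) * emeasure M {..<s} + (\<integral>\<^sup>+u. ennreal (indicator {..<s} u) * tail ?G u \<partial>M)"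
      by (subst nn_integral_add) (auto simp: nn_integral_cmult_indicator)
    finally show ?thesis .
  qed
  have "(\<integral>\<^sup>+u. ennreal (indicator {..<s} u) * tail ?G u \<partial>M)
      = (\<integral>\<^sup>+t. ?G t * left_mass (indicator {..<s}) t \<partial>N)"
    by (rule nn_integral_mult_tail) measurable
  also have "\<dots> \<le> (\<integral>\<^sup>+t\<in>einterval 0 (ereal s). ennreal (g t * (?d / phi t)) \<partial>N)"
  proof (rule nn_integral_mono_AE, use AE_N in eventually_elim)
    fix t assume t: "t \<in> einterval 0 D"
    have "left_mass (indicator {..<s}) t \<le> (\<integral>\<^sup>+u. indicator {..<t} u \<partial>M)"
      unfolding left_mass_def by (rule nn_integral_mono) (auto split: split_indicator)
    also have "\<dots> = emeasure M {..<t}" by simp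
    finally have "left_mass (indicator {..<s}) t \<le> ennreal (?d / phi t)"
      using M_le_delta_div_phi[OF t] by (rule order_trans)
    then have "ennreal (g t) * left_mass (indicator {..<s}) t \<le> ennreal (g t * (?d / phi t))"
      unfolding ennreal_mult'[OF g0] by (rule mult_left_mono) simp
    then show "?G t * left_mass (indicator {..<s}) t
        \<le> ennreal (g t * (?d / phi t)) * indicator (einterval 0 (ereal s)) t"
      using t by (auto simp: einterval_def split: split_indicator)
  qed
  also have "\<dots> \<le> ennreal (?d / sqrt (phi s))"
  proof (rule nn_integral_einterval_le)
    fix u v assume uv: "0 < ereal u" "u < v" "ereal v < ereal s"
    have "(\<integral>\<^sup>+t\<in>{u..v}. ennreal (g t * (?d / phi t)) \<partial>N) = ennreal (?d / sqrt (phi v) - ?d / sqrt (phi u))"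
    proof (rule nn_integral_N_FTC[where G="\<lambda>t. ?d / sqrt (phi t)"])
      fix t assume "u \<le> t" "t \<le> v"
      then have t: "t \<in> einterval 0 D" using uv by (intro dom) auto
      show "((\<lambda>t. ?d / sqrt (phi t)) has_real_derivative g t * (?d / phi t) * r t) (at t)"
        using phi_pos[OF t]
        by (intro DERIV_cong[OF DERIV_divide[OF DERIV_const sqrt_phi_deriv[OF t]]]) (simp_all add: g_def)
      show "0 \<le> g t * (?d / phi t)" by (simp add: phi_def)
    qed (use uv in \<open>auto intro!: dom\<close>)
    also have "\<dots> \<le> ennreal (?d / sqrt (phi s))"
    proof (rule ennreal_leI)
      have "?d / sqrt (phi v) \<le> ?d / sqrt (phi s)"
        using phi_pos[OF s] phi_antimono[of v s] uv by (intro divide_left_mono) auto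
      moreover have "0 \<le> ?d / sqrt (phi u)" by (simp add: phi_def)
      ultimately show "?d / sqrt (phi v) - ?d / sqrt (phi u) \<le> ?d / sqrt (phi s)" by linarith
    qed
    finally show "(\<integral>\<^sup>+t\<in>{u..v}. ennreal (g t * (?d / phi t)) \<partial>N) \<le> ennreal (?d / sqrt (phi s))" .
  qed (use s in \<open>auto simp: mem_dom\<close>)
  finally have "left_mass (\<lambda>x. sqrt (phi x)) s
      \<le> ennreal (sqrt (phi s)) * emeasure M {..<s} + ennreal (?d / sqrt (phi s))"
    unfolding split by (rule add_left_mono)
  also have "\<dots> \<le> ennreal (sqrt (phi s)) * ennreal (?d / phi s) + ennreal (?d / sqrt (phi s))"
    by (intro add_right_mono mult_left_mono M_le_delta_div_phi[OF s]) simp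
  also have "\<dots> = ennreal (2 * ?d / sqrt (phi s))"
    using phi_pos[OF s]
    by (simp add: real_div_sqrt field_simps flip: ennreal_mult' ennreal_plus)
  finally show ?thesis .
qed

text \<open>
  The preceding bound is the derivative of \<open>- 4 \<delta> \<surd>\<phi>\<close> with respect to \<open>\<nu>\<close>.
\<close>

lemma tail_left_mass_sqrt_phi:
  assumes x: "x \<in> einterval 0 D"
  shows "tail (left_mass (\<lambda>x. sqrt (phi x))) x \<le> 4 * delta a b D * ennreal (sqrt (phi x))"
proof -
  let ?d = "enn2real (delta a b D)"
  let ?g = "\<lambda>s. 2 * ?d / sqrt (phi s)"
  have "tail (left_mass (\<lambda>x. sqrt (phi x))) x \<le> (\<integral>\<^sup>+s\<in>einterval (ereal x) D. ennreal (?g s) \<partial>N)"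
    unfolding tail_def
    by (rule nn_integral_mono_AE, use AE_N in eventually_elim)
       (auto simp: left_mass_sqrt_phi einterval_def split: split_indicator)
  also have "\<dots> \<le> ennreal (4 * ?d * sqrt (phi x))"
  proof (rule nn_integral_einterval_le)
    fix u v assume uv: "ereal x < ereal u" "u < v" "ereal v < D"
    have dom: "t \<in> einterval 0 D" if "u \<le> t" "t \<le> v" for t
      using that uv x below_D[of t v] by (auto simp: mem_dom)
    have "(\<integral>\<^sup>+t\<in>{u..v}. ennreal (?g t) \<partial>N) = ennreal (- 4 * ?d * sqrt (phi v) - (- 4 * ?d * sqrt (phi u)))"
    proof (rule nn_integral_N_FTC[where G="\<lambda>t. - 4 * ?d * sqrt (phi t)"])
      fix t assume "u \<le> t" "t \<le> v"
      then have t: "t \<in> einterval 0 D" using dom by auto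
      show "((\<lambda>t. - 4 * ?d * sqrt (phi t)) has_real_derivative ?g t * r t) (at t)"
        by (rule DERIV_cong[OF DERIV_cmult[OF sqrt_phi_deriv[OF t]]]) simp
      show "0 \<le> ?g t" by (simp add: phi_def)
    qed (use uv dom in auto)
    also have "\<dots> \<le> ennreal (4 * ?d * sqrt (phi x))"
    proof (rule ennreal_leI)
      have "4 * ?d * sqrt (phi u) \<le> 4 * ?d * sqrt (phi x)"
        using phi_antimono[of x u] uv by (intro mult_left_mono) auto
      moreover have "0 \<le> 4 * ?d * sqrt (phi v)" by (simp add: phi_def)
      ultimately show "- 4 * ?d * sqrt (phi v) - (- 4 * ?d * sqrt (phi u)) \<le> 4 * ?d * sqrt (phi x)" by linarith
    qed
    finally show "(\<integral>\<^sup>+t\<in>{u..v}. ennreal (?g t) \<partial>N) \<le> ennreal (4 * ?d * sqrt (phi x))" .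
  qed (use x in \<open>auto simp: mem_dom\<close>)
  also have "\<dots> = 4 * delta a b D * ennreal (sqrt (phi x))"
    using delta_finite by (simp add: ennreal_mult')
  finally show ?thesis .
qed

definition iterate :: "(real \<Rightarrow> real) \<Rightarrow> real \<Rightarrow> real" where
  "iterate f x = enn2real (ennreal (f x) * II a b D f x)"

lemma II_le_iff:
  assumes "positive f" "x \<in> einterval 0 D"
  shows "II a b D f x \<le> c \<longleftrightarrow> tail (left_mass f) x \<le> c * ennreal (f x)"
proof
  have y: "ennreal (f x) \<noteq> 0" "ennreal (f x) < top" using positiveD[OF assms] by auto
  assume "II a b D f x \<le> c"
  then have "tail (left_mass f) x / ennreal (f x) * ennreal (f x) \<le> c * ennreal (f x)"
    unfolding positive_mult_II(1)[OF assms] by (rule mult_right_mono) simp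
  then show "tail (left_mass f) x \<le> c * ennreal (f x)"
    using y by (simp add: ennreal_divide_times)
next
  assume "tail (left_mass f) x \<le> c * ennreal (f x)"
  then show "II a b D f x \<le> c"
    unfolding positive_mult_II(1)[OF assms] using positiveD[OF assms]
    by (intro divide_le_posI_ennreal) (auto simp: mult.commute)
qed

text \<open>
  The supersolution inequality says that the next function is at most \<open>c f\<close>. Applying the monotone
  operator \<open>tail (left_mass _)\<close> to it gives the same inequality one step later.
\<close>

lemma iterate_positive:
  assumes f: "positive f" and "c < \<infinity>"
    and super: "\<And>x. x \<in> einterval 0 D \<Longrightarrow> tail (left_mass f) x \<le> c * ennreal (f x)"
  shows "positive (iterate f)"
    and "\<And>x. x \<in> einterval 0 D \<Longrightarrow> ennreal (iterate f x) = tail (left_mass f) x"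
    and "\<And>x. x \<in> einterval 0 D \<Longrightarrow> tail (left_mass (iterate f)) x \<le> c * ennreal (iterate f x)"
proof -
  have [measurable]: "f \<in> borel_measurable borel" using f by (simp add: positive_def)
  have meas [measurable]: "iterate f \<in> borel_measurable borel"
    unfolding iterate_def[abs_def] II_eq by measurable
  show eq: "ennreal (iterate f x) = tail (left_mass f) x" if x: "x \<in> einterval 0 D" for x
  proof -
    have "c * ennreal (f x) < top" using \<open>c < \<infinity>\<close> by (simp add: ennreal_mult_less_top)
    with super[OF x] have "tail (left_mass f) x < top" by (rule order_le_less_trans)
    then show ?thesis by (simp add: iterate_def positive_mult_II(2)[OF f x])
  qed
  show "positive (iterate f)"
    unfolding positive_def using tail_left_mass_pos[OF f] by (auto simp flip: eq)
  show "tail (left_mass (iterate f)) x \<le> c * ennreal (iterate f x)" if x: "x \<in> einterval 0 D" for x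
    unfolding eq[OF x]
  proof (rule tail_le)
    fix s
    show "left_mass (iterate f) s \<le> c * left_mass f s"
      by (rule left_mass_le) (use super eq in auto)
  qed measurable
qed

lemma f_seq_Suc: "f_seq a b D (Suc (Suc n)) = iterate (f_seq a b D (Suc n))"
  by (simp add: f_seq_def iterate_def[abs_def])

lemma f_seq_1: "f_seq a b D (Suc 0) = (\<lambda>x. sqrt (phi x))"
  by (simp add: f_seq_def phi_def measure_def emeasure_N_einterval)

lemma delta_n_le_iff:
  assumes "positive (f_seq a b D n)"
  shows "delta_n a b D n \<le> c \<longleftrightarrow>
    (\<forall>x\<in>einterval 0 D. tail (left_mass (f_seq a b D n)) x \<le> c * ennreal (f_seq a b D n x))"
  unfolding delta_n_def SUP_le_iff by (rule ball_cong[OF refl]) (rule II_le_iff[OF assms])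

lemma f_seq_supersolution:
  "positive (f_seq a b D (Suc n)) \<and> delta_n a b D (Suc n) \<le> 4 * delta a b D"
proof (induction n)
  case 0
  have "positive (f_seq a b D (Suc 0))"
    by (auto simp: f_seq_1 positive_def phi_pos)
  then show ?case
    by (simp add: delta_n_le_iff) (simp add: f_seq_1 tail_left_mass_sqrt_phi)
next
  case (Suc n)
  have "4 * delta a b D < \<infinity>" using delta_finite by (simp add: ennreal_mult_less_top)
  note it = iterate_positive[OF conjunct1[OF Suc.IH] this]
  have super: "tail (left_mass (f_seq a b D (Suc n))) x \<le> 4 * delta a b D * ennreal (f_seq a b D (Suc n) x)"
    if "x \<in> einterval 0 D" for x
    using Suc.IH that by (auto simp: delta_n_le_iff)
  show ?case
    using it[OF super] by (simp add: f_seq_Suc delta_n_le_iff)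
qed

lemma delta_n_finite: "delta_n a b D (Suc n) < \<infinity>"
  using delta_finite
  by (intro order_le_less_trans[OF conjunct2[OF f_seq_supersolution]]) (simp add: ennreal_mult_less_top)

lemma delta_n_super:
  "x \<in> einterval 0 D \<Longrightarrow> tail (left_mass (f_seq a b D (Suc n))) x
    \<le> delta_n a b D (Suc n) * ennreal (f_seq a b D (Suc n) x)"
  using delta_n_le_iff[OF conjunct1[OF f_seq_supersolution], THEN iffD1, OF order_refl] by (rule bspec)

lemma delta_n_Suc_le: "delta_n a b D (Suc (Suc n)) \<le> delta_n a b D (Suc n)"
  by (rule delta_n_le_iff[OF conjunct1[OF f_seq_supersolution], THEN iffD2], rule ballI, unfold f_seq_Suc,
      rule iterate_positive(3)[OF conjunct1[OF f_seq_supersolution] delta_n_finite delta_n_super])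

lemma delta_n_antimono:
  assumes "1 \<le> i" "i \<le> j"
  shows "delta_n a b D j \<le> delta_n a b D i"
proof -
  have "decseq (\<lambda>n. delta_n a b D (Suc n))" by (rule decseq_SucI) (rule delta_n_Suc_le)
  from decseqD[OF this, of "i - 1" "j - 1"] assms show ?thesis by simp
qed

lemma lambda0_ge: "inverse (delta_n a b D (Suc n)) \<le> lambda0 a b D"
  by (rule inverse_le_lambda0[OF conjunct1[OF f_seq_supersolution] delta_n_finite delta_n_super])

end

section \<open>Test functions bound the eigenvalue from above\<close>

text \<open>
  The defining infimum of \<open>\<lambda>\<^sub>0\<close> without the normalisation \<open>\<mu>(g\<^sup>2) = 1\<close>.
\<close>

lemma lambda0_mult_mu_sq_le:
  assumes g: "g \<in> C_K D" and gD: "D < \<infinity> \<longrightarrow> g (real_of_ereal D) = 0"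
    and meas: "g \<in> borel_measurable borel" and fin: "mu_sq a b D g < \<infinity>"
  shows "lambda0 a b D * mu_sq a b D g \<le> dirichlet a b D g"
proof (cases "mu_sq a b D g = 0")
  case False
  note meas [measurable]
  obtain \<mu> where \<mu>: "mu_sq a b D g = ennreal \<mu>" "0 < \<mu>"
    using fin False by (cases "mu_sq a b D g") auto
  define c where "c = 1 / sqrt \<mu>"
  have c: "0 < c" "c\<^sup>2 = 1 / \<mu>" using \<mu> by (auto simp: c_def power_divide)
  let ?g = "\<lambda>x. c * g x"
  obtain d where d [measurable]: "d \<in> borel_measurable borel" and dc: "continuous_on (einterval 0 D) d"
    and deriv: "\<And>x. x \<in> einterval 0 D \<Longrightarrow> (g has_real_derivative d x) (at x)"
    and dir: "dirichlet a b D g = (\<integral>\<^sup>+x. ennreal ((d x / r x)\<^sup>2) \<partial>N)"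
    using C_K_derivative[OF g] by blast
  have deriv': "(?g has_real_derivative c * d x) (at x)" if "x \<in> einterval 0 D" for x
    by (rule DERIV_cmult[OF deriv[OF that]])
  have "?g C1_differentiable_on einterval 0 D"
    unfolding C1_differentiable_on_def
  proof (intro exI[of _ "\<lambda>x. c * d x"] conjI ballI)
    show "(?g has_vector_derivative c * d x) (at x)" if "x \<in> einterval 0 D" for x
      using deriv'[OF that] by (simp add: has_real_derivative_iff_has_vector_derivative)
    show "continuous_on (einterval 0 D) (\<lambda>x. c * d x)" by (intro continuous_intros dc)
  qed
  moreover have "{x \<in> closed_dom D. ?g x \<noteq> 0} = {x \<in> closed_dom D. g x \<noteq> 0}" using c by auto
  ultimately have "?g \<in> C_K D" using g by (auto simp: C_K_def intro!: continuous_intros)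
  moreover have "mu_sq a b D ?g = 1"
  proof -
    have "mu_sq a b D ?g = (\<integral>\<^sup>+x. ennreal (c\<^sup>2) * ennreal ((g x)\<^sup>2) \<partial>M)"
      unfolding mu_sq_def by (simp add: power_mult_distrib ennreal_mult)
    also have "\<dots> = ennreal (c\<^sup>2) * mu_sq a b D g"
      unfolding mu_sq_def by (rule nn_integral_cmult) measurable
    also have "\<dots> = 1" using \<mu> c by (simp flip: ennreal_mult)
    finally show ?thesis .
  qed
  moreover have "D < \<infinity> \<longrightarrow> ?g (real_of_ereal D) = 0" using gD by simp
  ultimately have "lambda0 a b D \<le> dirichlet a b D ?g"
    unfolding lambda0_def by (intro Inf_lower) blast
  also have "dirichlet a b D ?g = ennreal (c\<^sup>2) * dirichlet a b D g"
  proof -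
    have "dirichlet a b D ?g = (\<integral>\<^sup>+x. ennreal ((c * d x / r x)\<^sup>2) \<partial>N)"
      by (rule dirichlet_eq) (auto intro!: AE_I2 DERIV_imp_deriv[OF deriv'])
    also have "\<dots> = (\<integral>\<^sup>+x. ennreal (c\<^sup>2) * ennreal ((d x / r x)\<^sup>2) \<partial>N)"
      by (simp add: power_mult_distrib ennreal_mult flip: times_divide_eq_right)
    also have "\<dots> = ennreal (c\<^sup>2) * dirichlet a b D g"
      unfolding dir by (rule nn_integral_cmult) measurable
    finally show ?thesis .
  qed
  finally have "lambda0 a b D * mu_sq a b D g \<le> ennreal (c\<^sup>2) * dirichlet a b D g * mu_sq a b D g"
    by (rule mult_right_mono) simp
  also have "\<dots> = (ennreal (c\<^sup>2) * ennreal \<mu>) * dirichlet a b D g" using \<mu> by (simp add: ac_simps)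
  also have "ennreal (c\<^sup>2) * ennreal \<mu> = 1" using \<mu> c by (simp flip: ennreal_mult)
  finally show ?thesis by simp
qed simp

lemma antiderivative_UNIV:
  fixes g :: "real \<Rightarrow> real"
  assumes "continuous_on UNIV g"
  obtains G where "\<And>x. (G has_real_derivative g x) (at x)"
proof -
  have "isCont g x" for x
    using assms by (simp add: continuous_on_eq_continuous_at)
  then obtain G where "\<forall>x::real. -\<infinity> < ereal x \<longrightarrow> ereal x < \<infinity> \<longrightarrow> (G has_vector_derivative g x) (at x)"
    using einterval_antiderivative[of "-\<infinity>" \<infinity> g] by auto
  then show ?thesis
    using that[of G] by (simp add: has_real_derivative_iff_has_vector_derivative)
qed

lemma continuous_on_r_min: "ereal y < D \<Longrightarrow> continuous_on UNIV (\<lambda>s. r (min s y))"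
proof -
  assume y: "ereal y < D"
  show ?thesis
    by (rule continuous_on_compose2[OF continuous_on_r])
       (use y in \<open>auto intro!: continuous_intros intro: below_D[OF _ y]\<close>)
qed

text \<open>
  The density \<open>r\<close> is frozen beyond \<open>x\<^sub>1\<close> by means of \<open>min s x1\<close>, since it may jump at \<open>D\<close>; this makes
  antiderivatives available on the whole line.
\<close>

lemma tail_FTC:
  assumes "0 \<le> x0" "x0 \<le> x1" "ereal x1 < D" "0 \<le> x" "x \<le> x1"
    and h: "continuous_on UNIV h" "\<And>s. 0 \<le> h s"
    and P: "\<And>s. (P has_real_derivative h s * r (min s x1)) (at s)"
  shows "tail (\<lambda>s. ennreal (h s) * indicator {x0<..<x1} s) x = ennreal (P x1 - P (max x x0))"
proof -
  have [measurable]: "h \<in> borel_measurable borel" using h(1) by (rule borel_measurable_continuous_onI)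
  have "tail (\<lambda>s. ennreal (h s) * indicator {x0<..<x1} s) x = (\<integral>\<^sup>+s\<in>{max x x0<..<x1}. ennreal (h s) \<partial>N)"
    unfolding tail_def by (rule nn_integral_cong) (auto split: split_indicator)
  also have "\<dots> = (\<integral>\<^sup>+s\<in>{max x x0<..<x1}. ennreal (h s * r s) \<partial>lborel)"
  proof (rule nn_integral_N)
    show "{max x x0<..<x1} \<subseteq> einterval 0 D"
    proof
      fix s assume "s \<in> {max x x0<..<x1}"
      then show "s \<in> einterval 0 D" using assms(3,4) below_D[of s x1] by (auto simp: mem_dom)
    qed
  qed (use h(2) in auto)
  also have "\<dots> = (\<integral>\<^sup>+s\<in>{max x x0..x1}. ennreal (h s * r (min s x1)) \<partial>lborel)"
    by (rule nn_integral_cong_AE, use AE_lborel_singleton[of "max x x0"] AE_lborel_singleton[of x1] in eventually_elim)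
       (auto split: split_indicator)
  also have "\<dots> = ennreal (P x1 - P (max x x0))"
  proof (rule nn_integral_FTC_Icc)
    show "(\<lambda>s. h s * r (min s x1)) \<in> borel_measurable borel" by measurable
    show "0 \<le> h s * r (min s x1)" for s using h(2) by simp
    show "max x x0 \<le> x1" using assms by simp
  qed (rule P)
  finally show ?thesis .
qed

text \<open>
  A continuous density that vanishes off \<open>(x\<^sub>0, x\<^sub>1)\<close> has no jumps at \<open>x\<^sub>0\<close> and \<open>x\<^sub>1\<close>, so its tail is
  continuously differentiable and is an admissible test function.
\<close>

lemma C1_tail_function:
  assumes x01: "0 \<le> x0" "x0 < x1" "ereal x1 < D"
    and h: "continuous_on UNIV h" "\<And>s. 0 \<le> h s" "\<And>s. s \<notin> {x0<..<x1} \<Longrightarrow> h s = 0"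
  obtains g where "g \<in> C_K D" "D < \<infinity> \<longrightarrow> g (real_of_ereal D) = 0" "g \<in> borel_measurable borel"
    "\<And>x. 0 \<le> x \<Longrightarrow> 0 \<le> g x" "\<And>x. 0 \<le> x \<Longrightarrow> ennreal (g x) = tail (\<lambda>s. ennreal (h s)) x"
    "dirichlet a b D g = (\<integral>\<^sup>+s. ennreal ((h s)\<^sup>2) \<partial>N)"
proof -
  have [measurable]: "h \<in> borel_measurable borel" using h(1) by (rule borel_measurable_continuous_onI)
  let ?q = "\<lambda>s. h s * r (min s x1)"
  have q: "continuous_on UNIV ?q" by (intro continuous_on_mult h continuous_on_r_min x01)
  obtain Q where Q: "\<And>s. (Q has_real_derivative ?q s) (at s)" using antiderivative_UNIV[OF q] by blast
  define g where "g x = Q x1 - Q x" for x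
  have deriv: "(g has_real_derivative - ?q x) (at x)" for x
    unfolding g_def[abs_def] by (rule derivative_eq_intros Q refl)+ simp
  have mono: "Q x \<le> Q y" if "x \<le> y" for x y
    by (rule DERIV_nonneg_imp_nondecreasing[OF that]) (use Q h(2) r_nonneg in \<open>meson mult_nonneg_nonneg\<close>)
  have zero: "g x = 0" if "x1 \<le> x" for x
  proof -
    have "Q x \<le> Q x1"
      by (rule DERIV_nonpos_imp_nonincreasing[OF that]) (use Q h(3) in \<open>auto intro!: exI[of _ "?q _"]\<close>)
    with mono[OF that] show ?thesis by (simp add: g_def)
  qed
  have cont: "continuous_on S g" for S
    by (intro continuous_at_imp_continuous_on ballI DERIV_isCont[OF deriv])
  have "g C1_differentiable_on einterval 0 D"
    unfolding C1_differentiable_on_def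
  proof (intro exI[of _ "\<lambda>x. - ?q x"] conjI ballI)
    show "(g has_vector_derivative - ?q x) (at x)" for x
      using deriv[of x] by (simp add: has_real_derivative_iff_has_vector_derivative)
    show "continuous_on (einterval 0 D) (\<lambda>x. - ?q x)"
      by (intro continuous_on_minus continuous_on_subset[OF q]) simp
  qed
  moreover have "compact (closure {x \<in> closed_dom D. g x \<noteq> 0})"
  proof -
    have "{x \<in> closed_dom D. g x \<noteq> 0} \<subseteq> {0..x1}"
    proof
      fix x assume "x \<in> {x \<in> closed_dom D. g x \<noteq> 0}"
      then show "x \<in> {0..x1}" using zero[of x] by (cases "x1 \<le> x") (auto simp: closed_dom_def)
    qed
    then show ?thesis by (meson bounded_closed_interval bounded_subset compact_closure)
  qed
  ultimately have 1: "g \<in> C_K D" by (simp add: C_K_def cont)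
  have 2: "D < \<infinity> \<longrightarrow> g (real_of_ereal D) = 0"
  proof
    assume "D < \<infinity>"
    then obtain e where "D = ereal e" using D_pos by (cases D) auto
    then show "g (real_of_ereal D) = 0" using x01 by (intro zero) simp
  qed
  have 3: "g \<in> borel_measurable borel" using cont by (rule borel_measurable_continuous_onI)
  have 4: "0 \<le> g x" for x
  proof (cases "x1 \<le> x")
    case False
    then show ?thesis using mono[of x x1] by (simp add: g_def)
  qed (simp add: zero)
  have 5: "ennreal (g x) = tail (\<lambda>s. ennreal (h s)) x" if "0 \<le> x" for x
  proof (cases "x \<le> x1")
    case True
    have "tail (\<lambda>s. ennreal (h s)) x = tail (\<lambda>s. ennreal (h s) * indicator {0<..<x1} s) x"
      by (rule tail_cong) (use h(3) x01 in \<open>auto split: split_indicator\<close>)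
    also have "\<dots> = ennreal (Q x1 - Q (max x 0))"
      by (rule tail_FTC) (use x01 h Q that True in auto)
    finally show ?thesis using that by (simp add: g_def)
  next
    case False
    have "tail (\<lambda>s. ennreal (h s)) x = tail (\<lambda>s. 0) x"
      by (rule tail_cong) (use h(3) False in auto)
    then show ?thesis using zero[of x] False by (simp add: tail_def)
  qed
  have 6: "dirichlet a b D g = (\<integral>\<^sup>+s. ennreal ((h s)\<^sup>2) \<partial>N)"
  proof -
    have "dirichlet a b D g = (\<integral>\<^sup>+x. ennreal ((- ?q x / r x)\<^sup>2) \<partial>N)"
    proof (rule dirichlet_eq)
      show "(\<lambda>x. - ?q x) \<in> borel_measurable borel" by measurable
    qed (auto intro!: AE_I2 DERIV_imp_deriv[OF deriv])
    also have "\<dots> = (\<integral>\<^sup>+s. ennreal ((h s)\<^sup>2) \<partial>N)"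
    proof (rule nn_integral_cong)
      fix s show "ennreal ((- ?q s / r s)\<^sup>2) = ennreal ((h s)\<^sup>2)"
        using h(3)[of s] by (cases "s < x1") (auto simp: min_def)
    qed
    finally show ?thesis .
  qed
  show ?thesis using that[OF 1 2 3 4 5 6] by blast
qed

section \<open>Tail functions\<close>

text \<open>
  The common shape of all the localised functions. The density \<open>h\<close> is required to be continuous on the
  whole line and is cut off sharply to \<open>(x\<^sub>0, x\<^sub>1)\<close>; values left of \<open>0\<close> are set to \<open>0\<close> as in the
  definition of the sequence.
\<close>

definition tail_function :: "real \<Rightarrow> real \<Rightarrow> (real \<Rightarrow> real) \<Rightarrow> (real \<Rightarrow> real) \<Rightarrow> bool" where
  "tail_function x0 x1 h f \<longleftrightarrow>
     continuous_on UNIV h \<and> (\<forall>s. 0 \<le> h s) \<and> (\<forall>s\<in>{x0<..<x1}. 0 < h s) \<and>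
     (\<forall>x. 0 \<le> f x) \<and> (\<forall>x<0. f x = 0) \<and>
     (\<forall>x\<ge>0. ennreal (f x) = tail (\<lambda>s. ennreal (h s) * indicator {x0<..<x1} s) x)"

context
  fixes x0 x1 :: real and h f :: "real \<Rightarrow> real"
  assumes x01: "0 \<le> x0" "x0 < x1" "ereal x1 < D"
    and tf: "tail_function x0 x1 h f"
begin

lemma tf_simps:
  shows h_cont: "continuous_on UNIV h" and h_nonneg: "0 \<le> h s"
    and h_pos: "x0 < s \<Longrightarrow> s < x1 \<Longrightarrow> 0 < h s"
    and f_nonneg: "0 \<le> f x" and f_neg: "x < 0 \<Longrightarrow> f x = 0"
    and f_eq_tail: "0 \<le> x \<Longrightarrow> ennreal (f x) = tail (\<lambda>s. ennreal (h s) * indicator {x0<..<x1} s) x"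
  using tf by (auto simp: tail_function_def)

lemma h_measurable [measurable]: "h \<in> borel_measurable borel"
  using h_cont by (rule borel_measurable_continuous_onI)

lemma f_measurable [measurable]: "f \<in> borel_measurable borel"
proof -
  have "f = (\<lambda>x. if x < 0 then 0 else enn2real (tail (\<lambda>s. ennreal (h s) * indicator {x0<..<x1} s) x))"
    using f_neg f_nonneg by (auto simp: fun_eq_iff simp flip: f_eq_tail)
  also have "\<dots> \<in> borel_measurable borel" by measurable
  finally show ?thesis .
qed

lemma f_zero: "x1 \<le> x \<Longrightarrow> f x = 0"
proof -
  assume "x1 \<le> x"
  then have "tail (\<lambda>s. ennreal (h s) * indicator {x0<..<x1} s) x = tail (\<lambda>s. 0) x"
    by (intro tail_cong) auto
  then have "ennreal (f x) = 0" using \<open>x1 \<le> x\<close> x01 by (simp add: f_eq_tail tail_def)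
  then show ?thesis using f_nonneg[of x] by simp
qed

lemma f_pos: "0 \<le> x \<Longrightarrow> x < x1 \<Longrightarrow> 0 < f x"
proof -
  assume x: "0 \<le> x" "x < x1"
  have "0 < (\<integral>\<^sup>+s\<in>{max x x0<..<x1}. ennreal (h s) \<partial>N)"
    by (rule nn_integral_N_pos) (use x x01 h_pos in \<open>auto simp: less_imp_le\<close>)
  also have "\<dots> = ennreal (f x)"
    unfolding f_eq_tail[OF x(1)] tail_def by (rule nn_integral_cong) (auto split: split_indicator)
  finally show ?thesis by simp
qed

lemma f_const: "0 \<le> x \<Longrightarrow> x \<le> x0 \<Longrightarrow> f x = f x0"
proof -
  assume x: "0 \<le> x" "x \<le> x0"
  have "ennreal (f x) = ennreal (f x0)"
    unfolding f_eq_tail[OF x(1)] f_eq_tail[OF x01(1)] tail_def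
    using x by (intro nn_integral_cong) (auto split: split_indicator)
  then show ?thesis using f_nonneg by simp
qed

lemma f_max: "0 \<le> x \<Longrightarrow> f (max x x0) = f x"
  using f_const[of x] by (cases "x \<le> x0") (auto simp: max_def)

lemma f_le: "f x \<le> f 0"
proof (cases "0 \<le> x")
  case True
  have "ennreal (f x) \<le> ennreal (f 0)"
    unfolding f_eq_tail[OF True] f_eq_tail[OF order_refl] by (rule tail_antimono) fact
  then show ?thesis using f_nonneg by simp
qed (use f_neg f_nonneg in auto)

lemma nn_integral_f_finite: "(\<integral>\<^sup>+u. ennreal (f u) \<partial>M) < \<infinity>"
proof -
  have "(\<integral>\<^sup>+u. ennreal (f u) \<partial>M) \<le> (\<integral>\<^sup>+u. ennreal (f 0) * indicator {..<x1} u \<partial>M)"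
    by (intro nn_integral_mono) (use f_le f_zero in \<open>auto simp: ennreal_leI split: split_indicator\<close>)
  also have "\<dots> = ennreal (f 0) * emeasure M {..<x1}" by (simp add: nn_integral_cmult_indicator)
  also have "\<dots> < \<infinity>" using M_finite[OF x01(3)] by (simp add: ennreal_mult_less_top)
  finally show ?thesis .
qed

lemma mu_sq_finite: "mu_sq a b D f < \<infinity>"
proof -
  have "mu_sq a b D f \<le> (\<integral>\<^sup>+u. ennreal (f 0) * ennreal (f u) \<partial>M)"
    unfolding mu_sq_def
    by (intro nn_integral_mono)
       (use f_le f_nonneg in \<open>auto simp: power2_eq_square intro!: ennreal_leI mult_right_mono simp flip: ennreal_mult\<close>)
  also have "\<dots> = ennreal (f 0) * (\<integral>\<^sup>+u. ennreal (f u) \<partial>M)"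
    by (rule nn_integral_cmult) measurable
  also have "\<dots> < \<infinity>" using nn_integral_f_finite by (simp add: ennreal_mult_less_top)
  finally show ?thesis .
qed

lemma left_mass_f_finite: "left_mass f s < \<infinity>"
proof -
  have "left_mass f s \<le> (\<integral>\<^sup>+u. ennreal (f u) \<partial>M)"
    unfolding left_mass_def by (intro nn_integral_mono) (auto split: split_indicator)
  then show ?thesis using nn_integral_f_finite by (rule order_le_less_trans)
qed

lemma left_mass_f_pos: "0 < s \<Longrightarrow> 0 < left_mass f s"
proof -
  assume s: "0 < s"
  have "0 < (\<integral>\<^sup>+u\<in>{0<..<min s x1}. ennreal (f u) \<partial>M)"
  proof (rule nn_integral_M_pos)
    show "0 < ennreal (f x)" if "0 < x" "x < min s x1" for x using f_pos[of x] that by simp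
    show "ereal (min s x1) \<le> D" by (rule less_imp_le[OF below_D[OF _ x01(3)]]) simp
  qed (use s x01 in auto)
  also have "\<dots> \<le> left_mass f s"
    unfolding left_mass_def by (intro nn_integral_mono) (auto split: split_indicator)
  finally show ?thesis .
qed

text \<open>
  Dominated convergence, because \<open>\<mu>\<close> has no atoms. It provides the continuous density of the next
  localised function.
\<close>

lemma left_mass_f_continuous: "continuous_on UNIV (\<lambda>s. enn2real (left_mass f s))"
proof (rule continuous_on_sequentiallyI)
  fix u :: "nat \<Rightarrow> real" and s assume u: "u \<longlonglongrightarrow> s"
  have "(\<lambda>n. left_mass f (u n)) \<longlonglongrightarrow> left_mass f s"
    unfolding left_mass_def
  proof (rule nn_integral_dominated_convergence[where w="\<lambda>u. ennreal (f u)"])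
    show "AE x in M. (\<lambda>n. ennreal (f x) * indicator {..<u n} x) \<longlonglongrightarrow> ennreal (f x) * indicator {..<s} x"
      using AE_M_neq[of s]
    proof eventually_elim
      fix x assume "x \<noteq> s"
      then consider "x < s" | "s < x" by linarith
      then have "\<forall>\<^sub>F n in sequentially. x < u n \<longleftrightarrow> x < s"
      proof cases
        case 1
        show ?thesis using order_tendstoD(1)[OF u 1] by eventually_elim (simp add: 1)
      next
        case 2
        show ?thesis using order_tendstoD(2)[OF u 2] by eventually_elim (use 2 in auto)
      qed
      then show "(\<lambda>n. ennreal (f x) * indicator {..<u n} x) \<longlonglongrightarrow> ennreal (f x) * indicator {..<s} x"
        by (intro tendsto_eventually, elim eventually_mono) (auto split: split_indicator)
    qed
  qed (use nn_integral_f_finite in \<open>auto split: split_indicator\<close>)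
  then show "(\<lambda>n. enn2real (left_mass f (u n))) \<longlonglongrightarrow> enn2real (left_mass f s)"
    using left_mass_f_finite[of s] by (intro tendsto_enn2real) auto
qed

lemma mult_II:
  assumes x: "0 \<le> x" "x < x1"
  shows "II a b D f x = tail (\<lambda>s. left_mass f s * indicator {..<x1} s) x / ennreal (f x)"
    and "ennreal (f x) * II a b D f x = tail (\<lambda>s. left_mass f s * indicator {..<x1} s) x"
proof -
  have "tail (\<lambda>s. left_mass f s * indicator {s. f s \<noteq> 0} s) x
      = tail (\<lambda>s. left_mass f s * indicator {..<x1} s) x"
  proof (rule tail_cong)
    fix s assume "x < s"
    then show "left_mass f s * indicator {s. f s \<noteq> 0} s = left_mass f s * indicator {..<x1} s"
      using f_pos[of s] f_zero[of s] x by (cases "s < x1") auto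
  qed
  then show 1: "II a b D f x = tail (\<lambda>s. left_mass f s * indicator {..<x1} s) x / ennreal (f x)"
    by (simp add: II_eq)
  show "ennreal (f x) * II a b D f x = tail (\<lambda>s. left_mass f s * indicator {..<x1} s) x"
    unfolding 1 using f_pos[OF x]
    by (simp add: ennreal_times_divide mult_divide_eq_ennreal mult.commute[of "ennreal (f x)"])
qed

text \<open>
  Between \<open>x\<^sub>0\<close> and \<open>x\<^sub>1\<close> the derivative is \<open>- h e\<^sup>-\<^sup>C\<close>, elsewhere \<open>0\<close>; only the two corners are
  excluded.
\<close>

lemma dirichlet_tail_function:
  "dirichlet a b D f = (\<integral>\<^sup>+s. ennreal ((h s)\<^sup>2) * indicator {x0<..<x1} s \<partial>N)"
proof -
  let ?p = "\<lambda>s. h s * r (min s x1)"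
  have p: "continuous_on UNIV ?p" by (intro continuous_on_mult h_cont continuous_on_r_min x01)
  obtain P where P: "\<And>s. (P has_real_derivative ?p s) (at s)" using antiderivative_UNIV[OF p] by blast
  have mono: "P x \<le> P y" if "x \<le> y" for x y
    by (rule DERIV_nonneg_imp_nondecreasing[OF that]) (use P h_nonneg r_nonneg in \<open>meson mult_nonneg_nonneg\<close>)
  have f_P: "f x = P x1 - P (max x x0)" if x: "0 \<le> x" "x \<le> x1" for x
  proof -
    have "ennreal (f x) = ennreal (P x1 - P (max x x0))"
      unfolding f_eq_tail[OF x(1)] by (rule tail_FTC) (use x01 x h_cont h_nonneg P in auto)
    then show ?thesis using f_nonneg[of x] mono[of "max x x0" x1] x x01 by simp
  qed
  define d where "d x = (if x \<in> {x0<..<x1} then - ?p x else 0)" for x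
  have deriv: "deriv f x = d x" if x: "x \<in> einterval 0 D" "x \<noteq> x0" "x \<noteq> x1" for x
  proof -
    have x': "0 < x" using x by (simp add: mem_dom)
    consider "x < x0" | "x0 < x" "x < x1" | "x1 < x" using x by linarith
    then show ?thesis
    proof cases
      case 1
      have "(f has_real_derivative 0) (at x)"
      proof (rule has_field_derivative_transform_within_open[where f="\<lambda>_. f x0" and S="{0<..<x0}"])
        show "f x0 = f y" if "y \<in> {0<..<x0}" for y using f_const[of y] that by simp
      qed (use 1 x' in auto)
      then show ?thesis using 1 by (auto simp: d_def dest: DERIV_imp_deriv)
    next
      case 2
      have "((\<lambda>x. P x1 - P x) has_real_derivative 0 - ?p x) (at x)"
        by (intro DERIV_diff DERIV_const P)
      then have "(f has_real_derivative 0 - ?p x) (at x)"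
        by (rule has_field_derivative_transform_within_open[where S="{x0<..<x1}"])
           (use 2 x01 f_P in auto)
      then show ?thesis using 2 by (auto simp: d_def dest: DERIV_imp_deriv)
    next
      case 3
      have "(f has_real_derivative 0) (at x)"
        by (rule has_field_derivative_transform_within_open[where f="\<lambda>_. 0" and S="{x1<..}"])
           (use 3 f_zero in auto)
      then show ?thesis using 3 by (auto simp: d_def dest: DERIV_imp_deriv)
    qed
  qed
  have "dirichlet a b D f = (\<integral>\<^sup>+x. ennreal ((d x / r x)\<^sup>2) \<partial>N)"
  proof (rule dirichlet_eq)
    show "d \<in> borel_measurable borel" unfolding d_def[abs_def] by measurable
    show "AE x in lborel. x \<in> einterval 0 D \<longrightarrow> deriv f x = d x"
      using AE_lborel_singleton[of x0] AE_lborel_singleton[of x1]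
      by eventually_elim (auto intro: deriv)
  qed
  also have "\<dots> = (\<integral>\<^sup>+s. ennreal ((h s)\<^sup>2) * indicator {x0<..<x1} s \<partial>N)"
    by (rule nn_integral_cong) (auto simp: d_def split: split_indicator)
  finally show ?thesis .
qed

lemma dirichlet_pos: "0 < dirichlet a b D f"
  unfolding dirichlet_tail_function
proof (rule nn_integral_N_pos)
  show "0 < ennreal ((h s)\<^sup>2)" if "x0 < s" "s < x1" for s using h_pos[OF that] by simp
qed (use x01 in \<open>auto simp: less_imp_le\<close>)

lemma dirichlet_finite: "dirichlet a b D f < \<infinity>"
proof -
  have "compact (h ` {x0..x1})"
    by (intro compact_continuous_image continuous_on_subset[OF h_cont]) auto
  then have "bdd_above (h ` {x0..x1})" by (intro bounded_imp_bdd_above compact_imp_bounded)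
  then obtain B where B: "\<forall>s\<in>{x0..x1}. h s \<le> B" by (auto simp: bdd_above_def)
  have "dirichlet a b D f \<le> (\<integral>\<^sup>+s. ennreal (B\<^sup>2) * indicator {..<x1} s \<partial>N)"
    unfolding dirichlet_tail_function
    by (intro nn_integral_mono)
       (use B h_nonneg in \<open>auto intro!: ennreal_leI power_mono split: split_indicator\<close>)
  also have "\<dots> = ennreal (B\<^sup>2) * emeasure N {..<x1}" by (simp add: nn_integral_cmult_indicator)
  also have "\<dots> < \<infinity>" using N_finite[OF x01(3)] by (simp add: ennreal_mult_less_top)
  finally show ?thesis .
qed

text \<open>
  Multiply \<open>h\<close> by piecewise linear cutoffs that increase to the indicator of \<open>(x\<^sub>0, x\<^sub>1)\<close>. The
  resulting \<open>C\<^sup>1\<close> test functions increase to \<open>f\<close>, and their energies are at most that of \<open>f\<close>, so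
  monotone convergence on the left-hand side is all that is needed.
\<close>

lemma lambda0_tail_function: "lambda0 a b D * mu_sq a b D f \<le> dirichlet a b D f"
proof -
  \<comment> \<open>distance to the complement of the interval, scaled by k and truncated at 1\<close>
  define cut where "cut k s = min 1 (real k * max 0 (min (s - x0) (x1 - s)))" for k :: nat and s
  define w where "w k s = h s * cut k s" for k s
  have cut: "0 \<le> cut k s" "cut k s \<le> 1" for k s
    by (auto simp: cut_def)
  have cut_Suc: "cut k s \<le> cut (Suc k) s" for k s
    unfolding cut_def by (intro min.mono order_refl mult_right_mono) auto
  have cut0: "cut k s = 0" if "s \<notin> {x0<..<x1}" for k s
  proof -
    have "min (s - x0) (x1 - s) \<le> 0" using that by (auto simp: min_le_iff_disj)
    then have "max 0 (min (s - x0) (x1 - s)) = 0" by (rule max_absorb1)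
    then show ?thesis unfolding cut_def by simp
  qed
  have w_cont: "continuous_on UNIV (w k)" for k
    unfolding w_def[abs_def] cut_def by (intro continuous_intros h_cont)
  have [measurable]: "w k \<in> borel_measurable borel" for k
    using w_cont by (rule borel_measurable_continuous_onI)
  have w_nonneg: "0 \<le> w k s" for k s using cut h_nonneg by (simp add: w_def)
  have w_zero: "w k s = 0" if "s \<notin> {x0<..<x1}" for k s using cut0[OF that] by (simp add: w_def)
  have w_inc: "incseq (\<lambda>k s. ennreal (w k s) * indicator {x<..} s)" for x
    unfolding w_def
    by (intro incseq_SucI le_funI mult_right_mono ennreal_leI mult_left_mono cut_Suc h_nonneg) simp
  have w_sup: "(SUP k. ennreal (w k s)) = ennreal (h s) * indicator {x0<..<x1} s" for s
  proof (cases "s \<in> {x0<..<x1}")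
    case True
    obtain k where "1 < real k * min (s - x0) (x1 - s)"
      using reals_Archimedean3[of "min (s - x0) (x1 - s)"] True by auto
    then have "cut k s = 1" using True by (auto simp: cut_def min_def max_def)
    then have "ennreal (h s) \<le> (SUP k. ennreal (w k s))"
      by (intro SUP_upper2[of k]) (auto simp: w_def)
    moreover have "(SUP k. ennreal (w k s)) \<le> ennreal (h s)"
      using cut(2) h_nonneg by (intro SUP_least ennreal_leI) (simp add: w_def mult_left_le)
    ultimately show ?thesis using True by auto
  next
    case False
    then show ?thesis using w_zero by simp
  qed
  have tail_inc: "tail (\<lambda>s. ennreal (w k s)) x \<le> tail (\<lambda>s. ennreal (w (Suc k) s)) x" for k x
    unfolding tail_def using incseq_SucD[OF w_inc[of x], of k]
    by (intro nn_integral_mono) (simp add: le_fun_def)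
  have tail_sup: "ennreal (f x) = (SUP k. tail (\<lambda>s. ennreal (w k s)) x)" if "0 \<le> x" for x
  proof -
    have "ennreal (f x) = (\<integral>\<^sup>+s. (SUP k. ennreal (w k s) * indicator {x<..} s) \<partial>N)"
      unfolding f_eq_tail[OF that] tail_def
      by (rule nn_integral_cong) (simp add: w_sup flip: SUP_mult_right_ennreal)
    also have "\<dots> = (SUP k. tail (\<lambda>s. ennreal (w k s)) x)"
      unfolding tail_def by (rule nn_integral_monotone_convergence_SUP[OF w_inc]) measurable
    finally show ?thesis .
  qed
  let ?T = "\<lambda>k x. tail (\<lambda>s. ennreal (w k s)) x"
  have sq_inc: "incseq (\<lambda>k x. (?T k x)\<^sup>2)"
    by (intro incseq_SucI le_funI power_mono tail_inc) auto
  have sq_sup: "ennreal ((f x)\<^sup>2) = (SUP k. (?T k x)\<^sup>2)" if "0 \<le> x" for x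
  proof (rule LIMSEQ_unique)
    have "(\<lambda>k. ?T k x) \<longlonglongrightarrow> ennreal (f x)"
      unfolding tail_sup[OF that] by (intro LIMSEQ_SUP incseq_SucI tail_inc)
    then have "(\<lambda>k. ?T k x * ?T k x) \<longlonglongrightarrow> ennreal (f x) * ennreal (f x)"
      by (intro tendsto_mult_ennreal) auto
    then show "(\<lambda>k. (?T k x)\<^sup>2) \<longlonglongrightarrow> ennreal ((f x)\<^sup>2)"
      using f_nonneg[of x] by (simp add: power2_eq_square ennreal_mult)
    show "(\<lambda>k. (?T k x)\<^sup>2) \<longlonglongrightarrow> (SUP k. (?T k x)\<^sup>2)"
      by (intro LIMSEQ_SUP incseq_SucI power_mono tail_inc) auto
  qed
  have approx: "lambda0 a b D * (\<integral>\<^sup>+x. (?T k x)\<^sup>2 \<partial>M) \<le> dirichlet a b D f" for k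
  proof -
    obtain g where g: "g \<in> C_K D" "D < \<infinity> \<longrightarrow> g (real_of_ereal D) = 0" "g \<in> borel_measurable borel"
      and g_nonneg: "\<And>x. 0 \<le> x \<Longrightarrow> 0 \<le> g x" and g_eq: "\<And>x. 0 \<le> x \<Longrightarrow> ennreal (g x) = ?T k x"
      and g_dir: "dirichlet a b D g = (\<integral>\<^sup>+s. ennreal ((w k s)\<^sup>2) \<partial>N)"
      using C1_tail_function[OF x01 w_cont w_nonneg w_zero, of k] by blast
    have mu: "(\<integral>\<^sup>+x. (?T k x)\<^sup>2 \<partial>M) = mu_sq a b D g"
      unfolding mu_sq_def
    proof (rule nn_integral_cong_AE, use AE_M in eventually_elim)
      fix x assume "x \<in> einterval 0 D"
      then have "0 \<le> x" by (simp add: mem_dom)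
      then show "(?T k x)\<^sup>2 = ennreal ((g x)\<^sup>2)"
        using g_nonneg by (simp add: ennreal_power flip: g_eq)
    qed
    have "(\<integral>\<^sup>+x. (?T k x)\<^sup>2 \<partial>M) \<le> mu_sq a b D f"
      unfolding mu_sq_def
    proof (rule nn_integral_mono_AE, use AE_M in eventually_elim)
      fix x assume "x \<in> einterval 0 D"
      then have "0 \<le> x" by (simp add: mem_dom)
      then show "(?T k x)\<^sup>2 \<le> ennreal ((f x)\<^sup>2)" unfolding sq_sup[OF \<open>0 \<le> x\<close>] by (intro SUP_upper) simp
    qed
    then have "mu_sq a b D g < \<infinity>" unfolding mu using mu_sq_finite by (rule order_le_less_trans)
    then have "lambda0 a b D * mu_sq a b D g \<le> dirichlet a b D g"
      by (rule lambda0_mult_mu_sq_le[OF g])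
    also have "\<dots> \<le> dirichlet a b D f"
      unfolding g_dir dirichlet_tail_function
    proof (rule nn_integral_mono)
      fix s
      show "ennreal ((w k s)\<^sup>2) \<le> ennreal ((h s)\<^sup>2) * indicator {x0<..<x1} s"
      proof (cases "s \<in> {x0<..<x1}")
        case True
        have "w k s \<le> h s" using cut(2) h_nonneg by (simp add: w_def mult_left_le)
        then show ?thesis using True w_nonneg by (auto intro!: ennreal_leI power_mono)
      qed (simp add: w_zero)
    qed
    finally show ?thesis by (simp add: mu)
  qed
  have "mu_sq a b D f = (\<integral>\<^sup>+x. (SUP k. (?T k x)\<^sup>2) \<partial>M)"
    unfolding mu_sq_def
    by (rule nn_integral_cong_AE, use AE_M in eventually_elim) (simp add: sq_sup mem_dom)
  also have "\<dots> = (SUP k. \<integral>\<^sup>+x. (?T k x)\<^sup>2 \<partial>M)"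
    by (rule nn_integral_monotone_convergence_SUP[OF sq_inc]) measurable
  finally have "lambda0 a b D * mu_sq a b D f = (SUP k. lambda0 a b D * (\<integral>\<^sup>+x. (?T k x)\<^sup>2 \<partial>M))"
    by (simp add: SUP_mult_left_ennreal)
  also have "\<dots> \<le> dirichlet a b D f" by (rule SUP_least) (rule approx)
  finally show ?thesis .
qed

lemma mu_sq_div_dirichlet_le: "mu_sq a b D f / dirichlet a b D f \<le> inverse (lambda0 a b D)"
proof (cases "mu_sq a b D f = 0")
  case False
  let ?m = "mu_sq a b D f" and ?d = "dirichlet a b D f" and ?l = "lambda0 a b D"
  obtain m d where md: "?m = ennreal m" "?d = ennreal d" "0 < m" "0 < d"
    using mu_sq_finite dirichlet_pos dirichlet_finite False by (cases ?m; cases ?d) auto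
  have le: "?l * ennreal m \<le> ennreal d" using lambda0_tail_function md by simp
  then have "?l \<noteq> top" using md by (auto simp: ennreal_top_mult top_unique)
  then obtain l where l: "?l = ennreal l" "0 \<le> l" by (cases ?l) auto
  show ?thesis
  proof (cases "l = 0")
    case False
    then have "l * m \<le> d" "0 < l" using le l md by (auto simp flip: ennreal_mult)
    then have "m / d \<le> inverse l" using md by (simp add: field_simps)
    then show ?thesis using md l \<open>0 < l\<close> by (simp add: divide_ennreal inverse_ennreal ennreal_leI)
  qed (use l in simp)
qed simp

end

\<comment> \<open>outside the block these two rules have premises with a density that cannot be inferred\<close>
declare h_measurable [measurable del] f_measurable [measurable del]

section \<open>The localised approximating sequences\<close>

definition local_iterate :: "real \<Rightarrow> real \<Rightarrow> (real \<Rightarrow> real) \<Rightarrow> real \<Rightarrow> real" where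
  "local_iterate x0 x1 f x =
     enn2real (ennreal (f (max x x0)) * II a b D f (max x x0)) * indicator {0..<x1} x"

lemma f_loc_Suc:
  "f_loc a b D x0 x1 (Suc (Suc n)) = local_iterate x0 x1 (f_loc a b D x0 x1 (Suc n))"
  by (simp add: f_loc_def local_iterate_def[abs_def])

context
  fixes x0 x1 :: real
  assumes x01: "0 \<le> x0" "x0 < x1" "ereal x1 < D"
begin

lemma tail_function_f_loc_1: "tail_function x0 x1 (\<lambda>_. 1) (f_loc a b D x0 x1 (Suc 0))"
proof -
  have "ennreal (f_loc a b D x0 x1 (Suc 0) x) = tail (\<lambda>s. ennreal 1 * indicator {x0<..<x1} s) x"
    if x: "0 \<le> x" for x
  proof -
    have "tail (\<lambda>s. ennreal 1 * indicator {x0<..<x1} s) x = (\<integral>\<^sup>+s. indicator {max x x0<..<x1} s \<partial>N)"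
      unfolding tail_def by (rule nn_integral_cong) (auto split: split_indicator)
    also have "\<dots> = emeasure N {max x x0<..<x1}" by simp
    also have "\<dots> = ennreal (measure N {max x x0<..<x1})"
    proof -
      have "emeasure N {max x x0<..<x1} \<le> emeasure N {..<x1}" by (rule emeasure_mono) auto
      then have "emeasure N {max x x0<..<x1} < top"
        using N_finite[OF x01(3)] by (auto intro: order_le_less_trans)
      then show ?thesis by (simp add: measure_def)
    qed
    also have "\<dots> = ennreal (f_loc a b D x0 x1 (Suc 0) x)"
      using x by (cases "x < x1") (simp_all add: f_loc_def del: ereal_max)
    finally show ?thesis by simp
  qed
  then show ?thesis
    by (auto simp: tail_function_def f_loc_def)
qed

lemma local_iterate:
  assumes tf: "tail_function x0 x1 h f"
  shows "tail_function x0 x1 (\<lambda>s. enn2real (left_mass f s)) (local_iterate x0 x1 f)"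
    and "\<And>x. 0 \<le> x \<Longrightarrow> x < x1 \<Longrightarrow>
      ennreal (local_iterate x0 x1 f x) = ennreal (f (max x x0)) * II a b D f (max x x0)"
proof -
  note fin = left_mass_f_finite[OF x01 tf]
  have eq: "ennreal (f (max x x0)) * II a b D f (max x x0)
      = tail (\<lambda>s. left_mass f s * indicator {x0<..<x1} s) x" if "0 \<le> x" "x < x1" for x
  proof -
    have "ennreal (f (max x x0)) * II a b D f (max x x0)
        = tail (\<lambda>s. left_mass f s * indicator {..<x1} s) (max x x0)"
      by (rule mult_II(2)[OF x01 tf]) (use that x01 in auto)
    also have "\<dots> = tail (\<lambda>s. left_mass f s * indicator {x0<..<x1} s) x"
      unfolding tail_def by (rule nn_integral_cong) (auto split: split_indicator)
    finally show ?thesis .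
  qed
  have fin_tail: "tail (\<lambda>s. left_mass f s * indicator {x0<..<x1} s) x < top" for x
  proof -
    have "tail (\<lambda>s. left_mass f s * indicator {x0<..<x1} s) x
        \<le> (\<integral>\<^sup>+s. left_mass f x1 * indicator {..<x1} s \<partial>N)"
      unfolding tail_def
      by (rule nn_integral_mono) (auto simp: left_mass_mono split: split_indicator)
    also have "\<dots> = left_mass f x1 * emeasure N {..<x1}" by (simp add: nn_integral_cmult_indicator)
    also have "\<dots> < top" using fin[of x1] N_finite[OF x01(3)] by (simp add: ennreal_mult_less_top)
    finally show ?thesis .
  qed
  show val: "ennreal (local_iterate x0 x1 f x) = ennreal (f (max x x0)) * II a b D f (max x x0)"
    if "0 \<le> x" "x < x1" for x
    using fin_tail[of x] that by (simp add: local_iterate_def eq)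
  have tail_eq: "ennreal (local_iterate x0 x1 f x)
      = tail (\<lambda>s. ennreal (enn2real (left_mass f s)) * indicator {x0<..<x1} s) x" if "0 \<le> x" for x
  proof -
    have "ennreal (local_iterate x0 x1 f x) = tail (\<lambda>s. left_mass f s * indicator {x0<..<x1} s) x"
    proof (cases "x < x1")
      case True
      then show ?thesis by (simp only: val[OF that True] eq[OF that True])
    next
      case False
      then have "tail (\<lambda>s. left_mass f s * indicator {x0<..<x1} s) x = tail (\<lambda>s. 0) x"
        by (intro tail_cong) auto
      then show ?thesis using False by (simp add: local_iterate_def tail_def)
    qed
    also have "\<dots> = tail (\<lambda>s. ennreal (enn2real (left_mass f s)) * indicator {x0<..<x1} s) x"
      by (rule tail_cong) (use fin in simp)
    finally show ?thesis .
  qed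
  have "0 < enn2real (left_mass f s)" if "x0 < s" for s
    using left_mass_f_pos[OF x01 tf, of s] fin[of s] that x01(1) by (simp add: enn2real_positive_iff)
  then show "tail_function x0 x1 (\<lambda>s. enn2real (left_mass f s)) (local_iterate x0 x1 f)"
    unfolding tail_function_def
    using tail_eq left_mass_f_continuous[OF x01 tf] by (auto simp: local_iterate_def)
qed

lemma f_loc_tail_function: "\<exists>h. tail_function x0 x1 h (f_loc a b D x0 x1 (Suc n))"
proof (induction n)
  case 0
  show ?case using tail_function_f_loc_1 by blast
next
  case (Suc n)
  then obtain h where "tail_function x0 x1 h (f_loc a b D x0 x1 (Suc n))" by blast
  from local_iterate(1)[OF this] show ?case unfolding f_loc_Suc by blast
qed

text \<open>
  This is where the evaluation at \<open>x \<or> x\<^sub>0\<close> is harmless: \<open>f\<close> is constant on \<open>[0, x\<^sub>0]\<close>.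
\<close>

lemma local_iterate_ge:
  assumes tf: "tail_function x0 x1 h f"
    and c: "\<And>x. 0 \<le> x \<Longrightarrow> x < x1 \<Longrightarrow> c \<le> II a b D f x"
  shows "c * ennreal (f x) \<le> ennreal (local_iterate x0 x1 f x)"
proof (cases "0 \<le> x \<and> x < x1")
  case True
  then have x: "0 \<le> x" "x < x1" by auto
  have "c * ennreal (f x) = ennreal (f (max x x0)) * c"
    by (simp add: f_max[OF x01 tf x(1)] mult.commute)
  also have "\<dots> \<le> ennreal (f (max x x0)) * II a b D f (max x x0)"
    by (intro mult_left_mono c) (use x x01 in auto)
  also have "\<dots> = ennreal (local_iterate x0 x1 f x)"
    by (rule local_iterate(2)[OF tf x, symmetric])
  finally show ?thesis .
next
  case False
  then have "f x = 0" using f_zero[OF x01 tf, of x] f_neg[OF x01 tf, of x] by linarith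
  then show ?thesis by simp
qed

text \<open>
  From \<open>c f \<le> F\<close> the operator \<open>f \<mapsto> f II(f)\<close> gains the factor \<open>c\<close>; since \<open>f II(f)\<close> is
  decreasing, its value at \<open>x\<close> dominates the one at \<open>x \<or> x\<^sub>0\<close>, which is \<open>F(x)\<close>.
\<close>

lemma le_II_local_iterate:
  assumes tf: "tail_function x0 x1 h f"
    and c: "\<And>x. 0 \<le> x \<Longrightarrow> x < x1 \<Longrightarrow> c \<le> II a b D f x"
    and x: "0 \<le> x" "x < x1"
  shows "c \<le> II a b D (local_iterate x0 x1 f) x"
proof -
  let ?F = "local_iterate x0 x1 f"
  note tF = local_iterate(1)[OF tf]
  have [measurable]: "f \<in> borel_measurable borel" "?F \<in> borel_measurable borel"
    using f_measurable[OF x01 tf] f_measurable[OF x01 tF] by auto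
  have mx: "0 \<le> max x x0" "max x x0 < x1" using x x01 by auto
  have F: "0 < ?F x" by (rule f_pos[OF x01 tF x])
  have left: "c * left_mass f s \<le> left_mass ?F s" for s
  proof -
    have "c * left_mass f s = (\<integral>\<^sup>+u. c * (ennreal (f u) * indicator {..<s} u) \<partial>M)"
      unfolding left_mass_def by (rule nn_integral_cmult[symmetric]) measurable
    also have "\<dots> \<le> left_mass ?F s"
      unfolding left_mass_def
      by (rule nn_integral_mono) (use local_iterate_ge[OF tf c] in \<open>auto split: split_indicator\<close>)
    finally show ?thesis .
  qed
  have "c * ennreal (?F x) = c * tail (\<lambda>s. left_mass f s * indicator {..<x1} s) (max x x0)"
    unfolding local_iterate(2)[OF tf x] by (subst mult_II(2)[OF x01 tf mx]) (rule refl)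
  also have "\<dots> \<le> c * tail (\<lambda>s. left_mass f s * indicator {..<x1} s) x"
    by (intro mult_left_mono tail_antimono) auto
  also have "\<dots> = (\<integral>\<^sup>+s. c * (left_mass f s * indicator {..<x1} s * indicator {x<..} s) \<partial>N)"
    unfolding tail_def by (rule nn_integral_cmult[symmetric]) measurable
  also have "\<dots> \<le> tail (\<lambda>s. left_mass ?F s * indicator {..<x1} s) x"
    unfolding tail_def by (rule nn_integral_mono) (use left in \<open>auto split: split_indicator\<close>)
  finally have "c * ennreal (?F x) / ennreal (?F x)
      \<le> tail (\<lambda>s. left_mass ?F s * indicator {..<x1} s) x / ennreal (?F x)"
    by (rule divide_right_mono_ennreal)
  also have "\<dots> = II a b D ?F x"
    by (rule mult_II(1)[OF x01 tF x, symmetric])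
  finally show ?thesis using F by (simp add: mult_divide_eq_ennreal)
qed

text \<open>
  \<open>F\<close> is the tail of the left mass of \<open>f\<close>, so the exchange of integrals turns
  \<open>D(F) = \<integral> (left_mass f)\<^sup>2 d\<nu>\<close> over \<open>(x\<^sub>0, x\<^sub>1)\<close> into \<open>\<mu>(f F)\<close>, and \<open>c f \<le> F\<close> bounds
  \<open>c \<mu>(f F)\<close> by \<open>\<mu>(F\<^sup>2)\<close>.
\<close>

lemma le_Rayleigh_local_iterate:
  assumes tf: "tail_function x0 x1 h f"
    and c: "\<And>x. 0 \<le> x \<Longrightarrow> x < x1 \<Longrightarrow> c \<le> II a b D f x"
  shows "c \<le> mu_sq a b D (local_iterate x0 x1 f) / dirichlet a b D (local_iterate x0 x1 f)"
proof -
  let ?F = "local_iterate x0 x1 f" and ?H = "\<lambda>s. enn2real (left_mass f s)"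
  let ?w = "\<lambda>s. ennreal (?H s) * indicator {x0<..<x1} s"
  note tF = local_iterate(1)[OF tf]
  have [measurable]: "f \<in> borel_measurable borel" "?F \<in> borel_measurable borel"
    using f_measurable[OF x01 tf] f_measurable[OF x01 tF] by auto
  have "dirichlet a b D ?F = (\<integral>\<^sup>+s. ?w s * left_mass f s \<partial>N)"
    unfolding dirichlet_tail_function[OF x01 tF]
    by (rule nn_integral_cong)
       (use left_mass_f_finite[OF x01 tf] in \<open>auto simp: power2_eq_square ennreal_mult split: split_indicator\<close>)
  also have "\<dots> = (\<integral>\<^sup>+x. ennreal (f x) * tail ?w x \<partial>M)"
    by (rule nn_integral_mult_tail[symmetric]) measurable
  also have "\<dots> = (\<integral>\<^sup>+x. ennreal (f x) * ennreal (?F x) \<partial>M)"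
    by (rule nn_integral_cong_AE, use AE_M in eventually_elim)
       (simp add: f_eq_tail[OF x01 tF] mem_dom)
  finally have "c * dirichlet a b D ?F = (\<integral>\<^sup>+x. c * (ennreal (f x) * ennreal (?F x)) \<partial>M)"
    by (simp only:) (rule nn_integral_cmult[symmetric], measurable)
  also have "\<dots> \<le> mu_sq a b D ?F"
    unfolding mu_sq_def
  proof (rule nn_integral_mono)
    fix x
    have "c * (ennreal (f x) * ennreal (?F x)) \<le> ennreal (?F x) * ennreal (?F x)"
      unfolding mult.assoc[symmetric] by (intro mult_right_mono local_iterate_ge[OF tf c]) auto
    also have "\<dots> = ennreal ((?F x)\<^sup>2)"
      using f_nonneg[OF x01 tF] by (simp add: power2_eq_square ennreal_mult)
    finally show "c * (ennreal (f x) * ennreal (?F x)) \<le> ennreal ((?F x)\<^sup>2)" .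
  qed
  finally have "c * dirichlet a b D ?F / dirichlet a b D ?F \<le> mu_sq a b D ?F / dirichlet a b D ?F"
    by (rule divide_right_mono_ennreal)
  then show ?thesis
    using dirichlet_pos[OF x01 tF] dirichlet_finite[OF x01 tF] by (simp add: mult_divide_eq_ennreal)
qed

text \<open>
  For \<open>h = 1\<close> energy and value at \<open>x\<^sub>0\<close> are both \<open>\<nu>(x\<^sub>0, x\<^sub>1)\<close>, and the exchange of integrals
  identifies the numerator of \<open>II(f)(x\<^sub>0)\<close> with \<open>\<mu>(f\<^sup>2)\<close>.
\<close>

lemma f_loc_1_Rayleigh:
  defines "f \<equiv> f_loc a b D x0 x1 (Suc 0)"
  shows "dirichlet a b D f = emeasure N {x0<..<x1}"
    and "ennreal (f x0) = emeasure N {x0<..<x1}"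
    and "II a b D f x0 = mu_sq a b D f / dirichlet a b D f"
proof -
  note tf = tail_function_f_loc_1[folded f_def]
  have [measurable]: "f \<in> borel_measurable borel" using f_measurable[OF x01 tf] .
  show dir: "dirichlet a b D f = emeasure N {x0<..<x1}"
    by (simp add: dirichlet_tail_function[OF x01 tf])
  have f_tail: "ennreal (f x) = tail (indicator {x0<..<x1}) x" if "0 \<le> x" for x
    using f_eq_tail[OF x01 tf that] by simp
  have "tail (indicator {x0<..<x1}) x0 = (\<integral>\<^sup>+s. indicator {x0<..<x1} s \<partial>N)"
    unfolding tail_def by (rule nn_integral_cong) (auto split: split_indicator)
  then show f0: "ennreal (f x0) = emeasure N {x0<..<x1}"
    by (simp add: f_tail[OF x01(1)])
  have "tail (\<lambda>s. left_mass f s * indicator {..<x1} s) x0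
      = (\<integral>\<^sup>+s. indicator {x0<..<x1} s * left_mass f s \<partial>N)"
    unfolding tail_def by (rule nn_integral_cong) (auto split: split_indicator)
  also have "\<dots> = (\<integral>\<^sup>+x. ennreal (f x) * tail (indicator {x0<..<x1}) x \<partial>M)"
    by (rule nn_integral_mult_tail[symmetric]) measurable
  also have "\<dots> = mu_sq a b D f"
    unfolding mu_sq_def
    by (rule nn_integral_cong_AE, use AE_M in eventually_elim)
       (use f_nonneg[OF x01 tf] in \<open>simp add: mem_dom power2_eq_square ennreal_mult flip: f_tail\<close>)
  finally have num: "tail (\<lambda>s. left_mass f s * indicator {..<x1} s) x0 = mu_sq a b D f" .
  show "II a b D f x0 = mu_sq a b D f / dirichlet a b D f"
    by (simp only: mult_II(1)[OF x01 tf x01(1,2)] num dir f0)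
qed

text \<open>
  To the left of \<open>x\<^sub>0\<close> the denominator is constant and the numerator decreasing. To the right,
  \<open>II(f)(x)\<close> is the \<open>\<nu>\<close>-average of the increasing function \<open>left_mass f\<close> over \<open>(x, x\<^sub>1)\<close>, and
  dropping the part \<open>(x\<^sub>0, x]\<close>, where that function is smallest, raises the average.
\<close>

lemma II_f_loc_1_ge:
  defines "f \<equiv> f_loc a b D x0 x1 (Suc 0)"
  assumes x: "0 \<le> x" "x < x1"
  shows "II a b D f x0 \<le> II a b D f x"
proof -
  note tf = tail_function_f_loc_1[folded f_def]
  have [measurable]: "f \<in> borel_measurable borel" using f_measurable[OF x01 tf] .
  let ?w = "\<lambda>s. left_mass f s * indicator {..<x1} s"
  note II = mult_II(1)[OF x01 tf]
  show ?thesis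
  proof (cases "x \<le> x0")
    case True
    then have "f x = f x0" by (rule f_const[OF x01 tf x(1)])
    then show ?thesis
      unfolding II[OF x] II[OF x01(1,2)]
      by (simp add: divide_right_mono_ennreal tail_antimono True)
  next
    case False
    let ?A = "\<integral>\<^sup>+s. left_mass f s * indicator {x0<..x} s \<partial>N" and ?B = "tail ?w x"
    let ?l = "left_mass f x" and ?p = "emeasure N {x0<..x}" and ?q = "emeasure N {x<..<x1}"
    have B_eq: "?B = (\<integral>\<^sup>+s. left_mass f s * indicator {x<..<x1} s \<partial>N)"
      unfolding tail_def by (rule nn_integral_cong) (auto split: split_indicator)
    have A: "?A \<le> ?l * ?p"
    proof -
      have "?A \<le> (\<integral>\<^sup>+s. ?l * indicator {x0<..x} s \<partial>N)"
        by (rule nn_integral_mono) (auto simp: left_mass_mono split: split_indicator)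
      then show ?thesis by (simp add: nn_integral_cmult_indicator)
    qed
    have B: "?l * ?q \<le> ?B"
    proof -
      have "(\<integral>\<^sup>+s. ?l * indicator {x<..<x1} s \<partial>N) \<le> ?B"
        unfolding B_eq by (rule nn_integral_mono) (auto simp: left_mass_mono split: split_indicator)
      then show ?thesis by (simp add: nn_integral_cmult_indicator)
    qed
    have AB: "tail ?w x0 = ?A + ?B"
    proof -
      have "tail ?w x0 = (\<integral>\<^sup>+s. left_mass f s * indicator {x0<..x} s + left_mass f s * indicator {x<..<x1} s \<partial>N)"
        unfolding tail_def by (rule nn_integral_cong) (use False x in \<open>auto split: split_indicator\<close>)
      also have "\<dots> = ?A + ?B" unfolding B_eq by (rule nn_integral_add) measurable
      finally show ?thesis .
    qed
    have fx: "ennreal (f x) = ?q"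
    proof -
      have "ennreal (f x) = tail (\<lambda>s. ennreal 1 * indicator {x0<..<x1} s) x" by (rule f_eq_tail[OF x01 tf x(1)])
      also have "\<dots> = (\<integral>\<^sup>+s. indicator {x<..<x1} s \<partial>N)"
        unfolding tail_def by (rule nn_integral_cong) (use False in \<open>auto split: split_indicator\<close>)
      finally show ?thesis by simp
    qed
    have fx0: "ennreal (f x0) = ?p + ?q"
    proof -
      have "{x0<..<x1} = {x0<..x} \<union> {x<..<x1}" using False x by auto
      then have "emeasure N {x0<..<x1} = ?p + ?q" by (simp add: plus_emeasure Int_def)
      then show ?thesis unfolding f_def f_loc_1_Rayleigh(2) .
    qed
    have q: "0 < ?q" "?q < top" using f_pos[OF x01 tf x] by (simp_all flip: fx)
    have pq: "0 < ?p + ?q" "?p + ?q < top" using f_pos[OF x01 tf x01(1,2)] by (simp_all flip: fx0)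
    \<comment> \<open>the claim (A + B) / (p + q) <= B / q with denominators cleared\<close>
    have "(?A + ?B) * ?q \<le> ?B * (?p + ?q)"
    proof -
      have "?A * ?q \<le> ?l * ?p * ?q" by (intro mult_right_mono A) simp
      also have "\<dots> = ?l * ?q * ?p" by (simp only: ac_simps)
      also have "\<dots> \<le> ?B * ?p" by (intro mult_right_mono B) simp
      finally show ?thesis by (simp add: distrib_left distrib_right add_right_mono)
    qed
    note cross = this
    have "(?A + ?B) / (?p + ?q) = (?A + ?B) * ?q / ?q / (?p + ?q)"
      using q by (simp only: mult_divide_eq_ennreal less_imp_neq[OF q(1), symmetric] less_imp_neq[OF q(2)] not_False_eq_True)
    also have "\<dots> \<le> ?B * (?p + ?q) / ?q / (?p + ?q)"
      by (intro divide_right_mono_ennreal cross)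
    also have "\<dots> = ?B / ?q * (?p + ?q) / (?p + ?q)"
      by (simp only: divide_ennreal_def mult_ac)
    also have "\<dots> = ?B / ?q"
      by (rule mult_divide_eq_ennreal[OF less_imp_neq[OF pq(1), symmetric] less_imp_neq[OF pq(2)]])
    finally show ?thesis
      unfolding II[OF x] II[OF x01(1,2)] AB fx fx0 .
  qed
qed

text \<open>
  Keep in \<open>\<mu>(f\<^sup>2)\<close> only the integral over \<open>(0, x\<^sub>0)\<close>, where \<open>f = \<nu>(x\<^sub>0, x\<^sub>1)\<close>.
\<close>

lemma Rayleigh_f_loc_1_ge:
  "emeasure M {..<x0} * emeasure N {x0<..<x1}
    \<le> mu_sq a b D (f_loc a b D x0 x1 (Suc 0)) / dirichlet a b D (f_loc a b D x0 x1 (Suc 0))"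
proof -
  define f where "f = f_loc a b D x0 x1 (Suc 0)"
  note tf = tail_function_f_loc_1[folded f_def]
  note R = f_loc_1_Rayleigh[folded f_def]
  let ?n = "emeasure N {x0<..<x1}"
  have "emeasure M {..<x0} * ?n * ?n = (\<integral>\<^sup>+x. ennreal ((f x0)\<^sup>2) * indicator {..<x0} x \<partial>M)"
  proof -
    have sq: "ennreal ((f x0)\<^sup>2) = ?n * ?n"
      using f_nonneg[OF x01 tf, of x0] by (simp add: power2_eq_square ennreal_mult R(2))
    have "(\<integral>\<^sup>+x. ennreal ((f x0)\<^sup>2) * indicator {..<x0} x \<partial>M) = ennreal ((f x0)\<^sup>2) * emeasure M {..<x0}"
      by (rule nn_integral_cmult_indicator) simp
    then show ?thesis unfolding sq by (simp only: ac_simps)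
  qed
  also have "\<dots> \<le> mu_sq a b D f"
    unfolding mu_sq_def
  proof (rule nn_integral_mono_AE, use AE_M in eventually_elim)
    fix x assume "x \<in> einterval 0 D"
    then show "ennreal ((f x0)\<^sup>2) * indicator {..<x0} x \<le> ennreal ((f x)\<^sup>2)"
      using f_const[OF x01 tf, of x] by (cases "x < x0") (auto simp: mem_dom)
  qed
  finally have "emeasure M {..<x0} * ?n * ?n / ?n \<le> mu_sq a b D f / ?n"
    by (rule divide_right_mono_ennreal)
  moreover have "0 < ?n" "?n < top"
    using dirichlet_pos[OF x01 tf] dirichlet_finite[OF x01 tf] by (simp_all add: R(1))
  ultimately have "emeasure M {..<x0} * ?n \<le> mu_sq a b D f / ?n"
    by (simp add: mult_divide_eq_ennreal)
  then show ?thesis by (simp add: R(1) flip: f_def)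
qed

end

lemma ordered_pairsD: "(x0, x1) \<in> ordered_pairs D \<Longrightarrow> 0 \<le> x0 \<and> x0 < x1 \<and> ereal x1 < D"
  by (simp add: ordered_pairs_def)

lemma delta'_n_le_delta_bar_Suc: "delta'_n a b D (Suc n) \<le> delta_bar a b D (Suc (Suc n))"
  unfolding delta'_n_def delta_bar_def
proof (rule SUP_mono, clarify)
  fix x0 x1 assume xx: "(x0, x1) \<in> ordered_pairs D"
  then have x01: "0 \<le> x0" "x0 < x1" "ereal x1 < D" by (auto dest: ordered_pairsD)
  obtain h where tf: "tail_function x0 x1 h (f_loc a b D x0 x1 (Suc n))"
    using f_loc_tail_function[OF x01] by blast
  have "(INF x\<in>{0..<x1}. II a b D (f_loc a b D x0 x1 (Suc n)) x)
      \<le> mu_sq a b D (f_loc a b D x0 x1 (Suc (Suc n))) / dirichlet a b D (f_loc a b D x0 x1 (Suc (Suc n)))"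
    unfolding f_loc_Suc by (rule le_Rayleigh_local_iterate[OF x01 tf]) (rule INF_lower, simp)
  then show "\<exists>m\<in>ordered_pairs D. (INF x\<in>{0..<x1}. II a b D (f_loc a b D x0 x1 (Suc n)) x)
      \<le> (case m of (x0, x1) \<Rightarrow> mu_sq a b D (f_loc a b D x0 x1 (Suc (Suc n))) / dirichlet a b D (f_loc a b D x0 x1 (Suc (Suc n))))"
    using xx by (intro bexI[of _ "(x0, x1)"]) auto
qed

lemma delta_bar_le_inverse_lambda0: "delta_bar a b D (Suc n) \<le> inverse (lambda0 a b D)"
  unfolding delta_bar_def
proof (rule SUP_least, clarify)
  fix x0 x1 assume "(x0, x1) \<in> ordered_pairs D"
  then have x01: "0 \<le> x0" "x0 < x1" "ereal x1 < D" by (auto dest: ordered_pairsD)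
  obtain h where tf: "tail_function x0 x1 h (f_loc a b D x0 x1 (Suc n))"
    using f_loc_tail_function[OF x01] by blast
  show "mu_sq a b D (f_loc a b D x0 x1 (Suc n)) / dirichlet a b D (f_loc a b D x0 x1 (Suc n))
      \<le> inverse (lambda0 a b D)"
    by (rule mu_sq_div_dirichlet_le[OF x01 tf])
qed

lemma delta'_n_le_Suc: "delta'_n a b D (Suc n) \<le> delta'_n a b D (Suc (Suc n))"
  unfolding delta'_n_def
proof (rule SUP_mono, clarify)
  fix x0 x1 assume xx: "(x0, x1) \<in> ordered_pairs D"
  then have x01: "0 \<le> x0" "x0 < x1" "ereal x1 < D" by (auto dest: ordered_pairsD)
  obtain h where tf: "tail_function x0 x1 h (f_loc a b D x0 x1 (Suc n))"
    using f_loc_tail_function[OF x01] by blast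
  have "(INF x\<in>{0..<x1}. II a b D (f_loc a b D x0 x1 (Suc n)) x)
      \<le> (INF x\<in>{0..<x1}. II a b D (f_loc a b D x0 x1 (Suc (Suc n))) x)"
    unfolding f_loc_Suc
    by (rule INF_greatest, rule le_II_local_iterate[OF x01 tf]) (rule INF_lower, simp_all)
  then show "\<exists>m\<in>ordered_pairs D. (INF x\<in>{0..<x1}. II a b D (f_loc a b D x0 x1 (Suc n)) x)
      \<le> (case m of (x0, x1) \<Rightarrow> INF x\<in>{0..<x1}. II a b D (f_loc a b D x0 x1 (Suc (Suc n))) x)"
    using xx by (intro bexI[of _ "(x0, x1)"]) auto
qed

lemma delta'_1_eq_delta_bar_1: "delta'_n a b D (Suc 0) = delta_bar a b D (Suc 0)"
  unfolding delta'_n_def delta_bar_def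
proof (rule SUP_cong[OF refl], clarify)
  fix x0 x1 assume "(x0, x1) \<in> ordered_pairs D"
  then have x01: "0 \<le> x0" "x0 < x1" "ereal x1 < D" by (auto dest: ordered_pairsD)
  let ?f = "f_loc a b D x0 x1 (Suc 0)"
  have "(INF x\<in>{0..<x1}. II a b D ?f x) = II a b D ?f x0"
  proof (rule antisym)
    show "(INF x\<in>{0..<x1}. II a b D ?f x) \<le> II a b D ?f x0" by (rule INF_lower) (use x01 in simp)
    show "II a b D ?f x0 \<le> (INF x\<in>{0..<x1}. II a b D ?f x)"
      by (rule INF_greatest) (simp add: II_f_loc_1_ge[OF x01])
  qed
  then show "(INF x\<in>{0..<x1}. II a b D ?f x) = mu_sq a b D ?f / dirichlet a b D ?f"
    by (simp only: f_loc_1_Rayleigh(3)[OF x01])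
qed

text \<open>
  The products \<open>\<mu>(0, x) \<nu>(x, y)\<close> with \<open>y < D\<close> are bounded by Rayleigh quotients; letting \<open>y\<close> increase to
  \<open>D\<close> is done by writing the limit product as an integral over \<open>(x, D)\<close>.
\<close>

lemma delta_le_delta_bar_1: "delta a b D \<le> delta_bar a b D (Suc 0)"
  unfolding delta_def
proof (rule SUP_least)
  fix x assume x: "x \<in> einterval 0 D"
  have "emeasure M (einterval 0 (ereal x)) * emeasure N (einterval (ereal x) D)
      = (\<integral>\<^sup>+s\<in>einterval (ereal x) D. emeasure M {..<x} \<partial>N)"
    by (simp add: emeasure_M_einterval nn_integral_cmult_indicator)
  also have "\<dots> \<le> delta_bar a b D (Suc 0)"
  proof (rule nn_integral_einterval_le)
    fix u v assume uv: "ereal x < ereal u" "u < v" "ereal v < D"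
    obtain y where y: "ereal v < ereal y" "ereal y < D" using ereal_dense2[OF uv(3)] by blast
    have x01: "0 \<le> x" "x < y" "ereal y < D" using x uv y by (auto simp: mem_dom)
    have "(\<integral>\<^sup>+s\<in>{u..v}. emeasure M {..<x} \<partial>N) \<le> emeasure M {..<x} * emeasure N {x<..<y}"
      using uv y by (simp add: nn_integral_cmult_indicator) (intro mult_left_mono emeasure_mono, auto)
    also have "\<dots> \<le> mu_sq a b D (f_loc a b D x y (Suc 0)) / dirichlet a b D (f_loc a b D x y (Suc 0))"
      by (rule Rayleigh_f_loc_1_ge[OF x01])
    also have "\<dots> \<le> delta_bar a b D (Suc 0)"
      unfolding delta_bar_def
      by (rule SUP_upper2[of "(x, y)"]) (use x01 in \<open>auto simp: ordered_pairs_def\<close>)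
    finally show "(\<integral>\<^sup>+s\<in>{u..v}. emeasure M {..<x} \<partial>N) \<le> delta_bar a b D (Suc 0)" .
  qed (use x in \<open>auto simp: mem_dom\<close>)
  finally show "emeasure M (einterval 0 (ereal x)) * emeasure N (einterval (ereal x) D)
      \<le> delta_bar a b D (Suc 0)" .
qed

lemma delta_le_delta'_n: "delta a b D \<le> delta'_n a b D (Suc n)"
proof (induction n)
  case 0
  show ?case using delta_le_delta_bar_1 by (simp only: delta'_1_eq_delta_bar_1)
next
  case (Suc n)
  then show ?case using delta'_n_le_Suc by (rule order_trans)
qed

end

lemma ennreal_inverse_inverse: "inverse (inverse c) = (c :: ennreal)"
proof (cases c)
  case (real t)
  then show ?thesis by (cases "t = 0") (simp_all add: inverse_ennreal)
qed simp

lemma ennreal_inverse_antimono: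
  fixes c d :: ennreal
  assumes "c \<le> d"
  shows "inverse d \<le> inverse c"
proof (cases c)
  case (real x)
  show ?thesis
  proof (cases d)
    case (real y)
    with \<open>c = ennreal x\<close> assms \<open>0 \<le> x\<close> show ?thesis
      by (cases "x = 0") (simp_all add: inverse_ennreal ennreal_leI le_imp_inverse_le)
  qed simp
next
  case top
  with assms show ?thesis by (simp add: top_unique)
qed

theorem theorem3:
  fixes a b :: "real \<Rightarrow> real" and D :: ereal
  assumes "0 < D"
    and "a \<in> borel_measurable (restrict_space borel (closed_dom D))"
    and "b \<in> borel_measurable (restrict_space borel (closed_dom D))"
    and "\<And>x. x \<in> einterval 0 D \<Longrightarrow> 0 < a x"
    and "locally_integrable_on (\<lambda>x. b x / a x) (closed_dom D)"
    and "locally_integrable_on (\<lambda>x. exp (Cfun a b x) / a x) (closed_dom D)"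
    and "delta a b D < \<infinity>"
  shows
    "(\<forall>m n. 1 \<le> m \<and> m \<le> n \<longrightarrow> delta_n a b D n \<le> delta_n a b D m) \<and>
     (\<forall>n\<ge>1. lambda0 a b D \<ge> inverse (delta_n a b D n) \<and>
            inverse (delta_n a b D n) \<ge> inverse (4 * delta a b D)) \<and>
     (\<forall>n\<ge>1. inverse (delta a b D) \<ge> inverse (delta'_n a b D n) \<and>
            inverse (delta'_n a b D n) \<ge> lambda0 a b D) \<and>
     (\<forall>n\<ge>1. inverse (delta_bar a b D n) \<ge> lambda0 a b D \<and>
            delta_bar a b D (n + 1) \<ge> delta'_n a b D n) \<and>
     delta_bar a b D 1 = delta'_n a b D 1"
proof -
  interpret mixed_eigenvalue_problem a b D
    by unfold_locales (use assms in auto)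
  note delta = assms(7)
  note antimono = ennreal_inverse_antimono
  have lambda0_le: "lambda0 a b D \<le> inverse c" if "c \<le> inverse (lambda0 a b D)" for c
    using antimono[OF that] by (simp add: ennreal_inverse_inverse)
  have 1: "\<forall>m n. 1 \<le> m \<and> m \<le> n \<longrightarrow> delta_n a b D n \<le> delta_n a b D m"
    using delta_n_antimono[OF delta] by blast
  have 2: "inverse (delta_n a b D n) \<le> lambda0 a b D \<and> inverse (4 * delta a b D) \<le> inverse (delta_n a b D n)"
    if n: "1 \<le> n" for n
  proof -
    obtain k where "n = Suc k" using n by (cases n) auto
    then show ?thesis
      using lambda0_ge[OF delta, of k] f_seq_supersolution[OF delta, of k] antimono by blast
  qed
  have 3: "inverse (delta'_n a b D n) \<le> inverse (delta a b D) \<and> lambda0 a b D \<le> inverse (delta'_n a b D n)"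
    if n: "1 \<le> n" for n
  proof -
    obtain k where k: "n = Suc k" using n by (cases n) auto
    have "delta'_n a b D n \<le> inverse (lambda0 a b D)"
      unfolding k by (rule order_trans[OF delta'_n_le_delta_bar_Suc delta_bar_le_inverse_lambda0])
    then show ?thesis
      using antimono[OF delta_le_delta'_n[of k]] lambda0_le unfolding k by blast
  qed
  have 4: "lambda0 a b D \<le> inverse (delta_bar a b D n) \<and> delta'_n a b D n \<le> delta_bar a b D (n + 1)"
    if n: "1 \<le> n" for n
  proof -
    obtain k where k: "n = Suc k" using n by (cases n) auto
    show ?thesis
      using lambda0_le[OF delta_bar_le_inverse_lambda0[of k]] delta'_n_le_delta_bar_Suc[of k]
      unfolding k by simp
  qed
  have 5: "delta_bar a b D 1 = delta'_n a b D 1"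
    by (simp add: delta'_1_eq_delta_bar_1)
  show ?thesis using 1 2 3 4 5 by blast
qed

end
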